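(* Let $\mathcal{P},\mathcal{S},\mathcal{P}'$ be TRSs such that $\mathcal{S}$ is left-linear, $\mathcal{P}$ is reversible, $\mathcal{P}' \subseteq \mathcal{P}\cup\mathcal{P}^{-1}$, and $\mathcal{S}$ is terminating relative to $\mathcal{P}'$. Suppose (i) $\mathrm{CP}(\mathcal{S},\mathcal{S}) \subseteq {\stackrel{*}{\to}}_{\mathcal{S}\cup\mathcal{P}'} \circ {\leftleftarrows}_{\mathcal{P}\cup\mathcal{P}^{-1}} \circ {\stackrel{*}{\gets}}_{\mathcal{S}\cup\mathcal{P}'}$, (ii) for every $\langle u,v\rangle_X \in \mathrm{PCP}_{in}(\mathcal{P}\cup\mathcal{P}^{-1},\mathcal{S})$ there exist a term $u'$ and a set of positions $V$ with $\mathcal{V}_V(u')\subseteq X$ such that either $u = u' \leftleftarrows_{V,\mathcal{P}\cup\mathcal{P}^{-1}} \circ \stackrel{*}{\gets}_{\mathcal{S}\cup\mathcal{P}'} v$ or $u \to_{\mathcal{S}} \circ \stackrel{*}{\to}_{\mathcal{S}\cup\mathcal{P}'} u' \leftleftarrows_{V,\mathcal{P}\cup\mathcal{P}^{-1}} \circ \stackrel{*}{\gets}_{\mathcal{S}\cup\mathcal{P}'} v$, and (iii) $\mathrm{CP}(\mathcal{S},\mathcal{P}\cup\mathcal{P}^{-1}) \subseteq ({\stackrel{*}{\to}}_{\mathcal{S}\cup\mathcal{P}'} \circ {\rightrightarrows}_{\mathcal{P}\cup\mathcal{P}^{-1}}) \cup ({\stackrel{*}{\to}}_{\mathcal{S}\cup\mathcal{P}'}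 \circ {\rightrightarrows}_{\mathcal{P}\cup\mathcal{P}^{-1}} \circ {\stackrel{*}{\gets}}_{\mathcal{S}\cup\mathcal{P}'} \circ {\gets}_{\mathcal{S}})$. Then $\mathcal{S}\cup\mathcal{P}$ is confluent.
   Context: Terms are built from a signature of fixed-arity function symbols and a set of variables; $\mathcal{V}(t)$ is the set of variables of $t$; positions are sequences of positive integers ($\epsilon$ the empty one), $t/p$ is the subterm at $p$, $t[s]_p$ the replacement; positions are parallel if neither is a prefix of the other. For a set $P$ of positions of $t$, $\mathcal{V}_P(t)=\bigcup_{p\in P}\mathcal{V}(t/p)$. A substitution maps variables to terms (finite domain), extended homomorphically. A rewrite rule $l\to r$ has $l$ not a variable and $\mathcal{V}(r)\subseteq\mathcal{V}(l)$; a TRS is a finite set of rules; $s\to_{\mathcal{R}}t$ iff $s/p=l\sigma$, $t=s[r\sigma]_p$ for some $l\to r\in\mathcal{R}$. $\mathcal{R}^{-1}=\{r\to l\mid l\to r\in\mathcal{R}\}$. Left-linear: no variable occurs twice in a left-hand side. $\mathcal{R}$ reversible: $s\to_{\mathcal{R}}t$ implies $t\stackrel{*}{\to}_{\mathcal{R}}s$; confluent: ${\stackrel{*}{\gets}}\circ{\stackrel{*}{\to}}\subseteq{\stackrel{*}{\to}}\circ{\stackrel{*}{\gets}}$. $\mathcal{S}$ terminating relative to $\mathcal{P}'$: ${\to_{\mathcal{S}}}\circ{\stackrel{*}{\to}_{\mathcal{P}'}}$ has no infinite chain. Parallel rewriting: $s\rightrightarrows_{U,\mathcal{R}} t$ iff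 $U=\{p_1,\dots,p_n\}$ ($n\ge0$) is a set of pairwise parallel positions of $s$, and there are rules $l_i\to r_i\in\mathcal{R}$ and substitutions $\theta_i$ with $s/p_i=l_i\theta_i$ and $t$ obtained from $s$ by replacing each $s/p_i$ by $r_i\theta_i$; $\rightrightarrows_{\mathcal{R}}$ is the union over all $U$; $t\leftleftarrows_{U,\mathcal{R}} s$ iff $s\rightrightarrows_{U,\mathcal{R}} t$. Critical pairs: for rules $l_1\to r_1\in\mathcal{R}$, $l_2\to r_2\in\mathcal{Q}$ with disjoint variables and a non-variable position $p$ of $l_2$ with mgu $\sigma$ of $l_1$ and $l_2/p$ (excluding $p=\epsilon$ when the rules are the same up to renaming), $\langle l_2[r_1]_p\sigma,r_2\sigma\rangle\in\mathrm{CP}(\mathcal{R},\mathcal{Q})$. Parallel critical pairs: for $n\ge1$, rules $l_1\to r_1,\dots,l_n\to r_n$ from $\mathcal{R}$ and $l'\to r'\in\mathcal{Q}$, all renamed to have mutually disjoint variables, pairwise parallel non-variable positions $p_1,\dots,p_n$ of $l'$ such that $\{l_i\approx l'/p_i\}_i$ is unifiable with mgu $\sigma$ (excluding the case $n=1$, $p_1=\epsilon$, $l_1\to r_1$ and $l'\to r'$ the same up to renaming), the pair $\langle l'[r_1,\dots,r_n]_{p_1,\dots,p_n}\sigma, r'\sigma\rangle_X$ with $X=\mathcal{V}_{\{p_1,\dots,p_n\}}(l'\sigma)$ is a parallel critical pair; $\mathrm{PCP}_{in}(\mathcal{R},\mathcal{Q})$ is the set of those with all $p_i\neq\epsilon$.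 For a set $C$ of pairs, $C\subseteq R$ means $u\,R\,v$ for all $\langle u,v\rangle\in C$. Reversed arrows are inverses; $\stackrel{*}{}$ reflexive-transitive closure; $\circ$ relational composition. *)

theory Defs
  imports Main "HOL-Library.Sublist"
begin

text \<open>
  The signature is the type \<open>'f\<close> together with an arity function \<open>ar\<close>. The datatype
  itself does not enforce arities; the terms over the signature are those satisfying
  \<open>wf_trm ar\<close>, and all rewrite relations, rules and substitutions below are restricted to them.
\<close>

datatype (funs: 'f, vars: 'v) trm = Var 'v | Fun 'f "('f, 'v) trm list"

type_synonym ('f, 'v) subst = "'v \<Rightarrow> ('f, 'v) trm"
type_synonym ('f, 'v) rule = "('f, 'v) trm \<times> ('f, 'v) trm"
type_synonym pos = "nat list"

fun wf_trm :: "('f \<Rightarrow> nat) \<Rightarrow> ('f, 'v) trm \<Rightarrow> bool" where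
  "wf_trm ar (Var x) \<longleftrightarrow> True"
| "wf_trm ar (Fun f ts) \<longleftrightarrow> length ts = ar f \<and> (\<forall>t \<in> set ts. wf_trm ar t)"

fun is_Var :: "('f, 'v) trm \<Rightarrow> bool" where
  "is_Var (Var x) \<longleftrightarrow> True"
| "is_Var (Fun f ts) \<longleftrightarrow> False"


subsection \<open>Positions\<close>

text \<open>Arguments are numbered from 1. \<open>subt_at t p\<close> and \<open>replace_at t p s\<close> are meaningful
  only for \<open>p \<in> poss t\<close>.\<close>

lemma size_nth_less [termination_simp]: "i < length ts \<Longrightarrow> size (ts ! i) < Suc (size_list size ts)"
  by (metis nth_mem size_list_estimation' order_refl le_imp_less_Suc)

fun poss :: "('f, 'v) trm \<Rightarrow> pos set" where
  "poss (Var x) = {[]}"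
| "poss (Fun f ts) = insert [] (\<Union>i \<in> {..<length ts}. {Suc i # p | p. p \<in> poss (ts ! i)})"

fun subt_at :: "('f, 'v) trm \<Rightarrow> pos \<Rightarrow> ('f, 'v) trm" where
  "subt_at t [] = t"
| "subt_at (Fun f ts) (i # p) = subt_at (ts ! (i - 1)) p"
| "subt_at (Var x) (i # p) = undefined"

fun replace_at :: "('f, 'v) trm \<Rightarrow> pos \<Rightarrow> ('f, 'v) trm \<Rightarrow> ('f, 'v) trm" where
  "replace_at t [] s = s"
| "replace_at (Fun f ts) (i # p) s = Fun f (ts[i - 1 := replace_at (ts ! (i - 1)) p s])"
| "replace_at (Var x) (i # p) s = undefined"

text \<open>Only used for pairwise parallel positions, where the order of the list is irrelevant.\<close>

definition replace_many ::
  "('f, 'v) trm \<Rightarrow> (pos \<times> ('f, 'v) trm) list \<Rightarrow> ('f, 'v) trm" where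
  "replace_many t qs = fold (\<lambda>(p, s) u. replace_at u p s) qs t"

definition vars_at :: "pos set \<Rightarrow> ('f, 'v) trm \<Rightarrow> 'v set" where
  "vars_at P t = (\<Union>p \<in> P. vars (subt_at t p))"


subsection \<open>Substitutions and unification\<close>

primrec subst_apply :: "('f, 'v) trm \<Rightarrow> ('f, 'v) subst \<Rightarrow> ('f, 'v) trm" (infixl "\<cdot>" 67) where
  "Var x \<cdot> \<sigma> = \<sigma> x"
| "Fun f ts \<cdot> \<sigma> = Fun f (map (\<lambda>t. t \<cdot> \<sigma>) ts)"

definition is_subst :: "('f \<Rightarrow> nat) \<Rightarrow> ('f, 'v) subst \<Rightarrow> bool" where
  "is_subst ar \<sigma> \<longleftrightarrow> finite {x. \<sigma> x \<noteq> Var x} \<and> (\<forall>x. wf_trm ar (\<sigma> x))"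

definition unifies :: "('f, 'v) subst \<Rightarrow> (('f, 'v) trm \<times> ('f, 'v) trm) set \<Rightarrow> bool" where
  "unifies \<sigma> E \<longleftrightarrow> (\<forall>(s, t) \<in> E. s \<cdot> \<sigma> = t \<cdot> \<sigma>)"

definition is_mgu ::
  "('f \<Rightarrow> nat) \<Rightarrow> ('f, 'v) subst \<Rightarrow> (('f, 'v) trm \<times> ('f, 'v) trm) set \<Rightarrow> bool" where
  "is_mgu ar \<sigma> E \<longleftrightarrow> is_subst ar \<sigma> \<and> unifies \<sigma> E \<and>
     (\<forall>\<tau>. is_subst ar \<tau> \<and> unifies \<tau> E \<longrightarrow>
        (\<exists>\<delta>. is_subst ar \<delta> \<and> (\<forall>x. \<tau> x = \<sigma> x \<cdot> \<delta>)))"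


subsection \<open>Term rewriting systems\<close>

definition is_trs :: "('f \<Rightarrow> nat) \<Rightarrow> ('f, 'v) rule set \<Rightarrow> bool" where
  "is_trs ar R \<longleftrightarrow> finite R \<and>
     (\<forall>(l, r) \<in> R. wf_trm ar l \<and> wf_trm ar r \<and> \<not> is_Var l \<and> vars r \<subseteq> vars l)"

definition linear_trm :: "('f, 'v) trm \<Rightarrow> bool" where
  "linear_trm t \<longleftrightarrow>
     (\<forall>p \<in> poss t. \<forall>q \<in> poss t. \<forall>x. subt_at t p = Var x \<and> subt_at t q = Var x \<longrightarrow> p = q)"

definition left_linear :: "('f, 'v) rule set \<Rightarrow> bool" where
  "left_linear R \<longleftrightarrow> (\<forall>(l, r) \<in> R. linear_trm l)"

text \<open>The rewrite relations are defined for arbitrary sets of pairs of terms, so that they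
  apply to the converse of a TRS as well.\<close>

definition rstep :: "('f \<Rightarrow> nat) \<Rightarrow> ('f, 'v) rule set \<Rightarrow> ('f, 'v) trm rel" where
  "rstep ar R = {(s, t). wf_trm ar s \<and> wf_trm ar t \<and>
     (\<exists>l r \<sigma> p. (l, r) \<in> R \<and> is_subst ar \<sigma> \<and> p \<in> poss s \<and>
        subt_at s p = l \<cdot> \<sigma> \<and> t = replace_at s p (r \<cdot> \<sigma>))}"

text \<open>\<open>sorted_wrt parallel\<close> says that the entries of the list are pairwise parallel
  (and hence distinct).\<close>

definition par_rstep_at ::
  "('f \<Rightarrow> nat) \<Rightarrow> ('f, 'v) rule set \<Rightarrow> pos set \<Rightarrow> ('f, 'v) trm rel" where
  "par_rstep_at ar R U = {(s, t). wf_trm ar s \<and> wf_trm ar t \<and>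
     (\<exists>qs :: (pos \<times> ('f, 'v) rule \<times> ('f, 'v) subst) list.
        U = set (map fst qs) \<and>
        sorted_wrt parallel (map fst qs) \<and>
        (\<forall>(p, (l, r), \<theta>) \<in> set qs.
           p \<in> poss s \<and> (l, r) \<in> R \<and> is_subst ar \<theta> \<and> subt_at s p = l \<cdot> \<theta>) \<and>
        t = replace_many s (map (\<lambda>(p, (l, r), \<theta>). (p, r \<cdot> \<theta>)) qs))}"

definition par_rstep :: "('f \<Rightarrow> nat) \<Rightarrow> ('f, 'v) rule set \<Rightarrow> ('f, 'v) trm rel" where
  "par_rstep ar R = (\<Union>U. par_rstep_at ar R U)"

definition reversible :: "('f \<Rightarrow> nat) \<Rightarrow> ('f, 'v) rule set \<Rightarrow> bool" where
  "reversible ar R \<longleftrightarrow> (\<forall>s t. (s, t) \<in> rstep ar R \<longrightarrow> (t, s) \<in> (rstep ar R)\<^sup>*)"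

definition confluent :: "('f \<Rightarrow> nat) \<Rightarrow> ('f, 'v) rule set \<Rightarrow> bool" where
  "confluent ar R \<longleftrightarrow>
     ((rstep ar R)\<^sup>*)\<inverse> O (rstep ar R)\<^sup>* \<subseteq> (rstep ar R)\<^sup>* O ((rstep ar R)\<^sup>*)\<inverse>"

definition terminating_relative_to ::
  "('f \<Rightarrow> nat) \<Rightarrow> ('f, 'v) rule set \<Rightarrow> ('f, 'v) rule set \<Rightarrow> bool" where
  "terminating_relative_to ar S R \<longleftrightarrow>
     \<not> (\<exists>f :: nat \<Rightarrow> ('f, 'v) trm. \<forall>i. (f i, f (Suc i)) \<in> rstep ar S O (rstep ar R)\<^sup>*)"


subsection \<open>Critical pairs\<close>

definition rule_vars :: "('f, 'v) rule \<Rightarrow> 'v set" where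
  "rule_vars \<rho> = vars (fst \<rho>) \<union> vars (snd \<rho>)"

definition variant :: "('f, 'v) rule \<Rightarrow> ('f, 'v) rule \<Rightarrow> bool" where
  "variant \<rho> \<rho>' \<longleftrightarrow> (\<exists>\<pi> :: 'v \<Rightarrow> 'v. bij \<pi> \<and>
     fst \<rho> = fst \<rho>' \<cdot> (\<lambda>x. Var (\<pi> x)) \<and> snd \<rho> = snd \<rho>' \<cdot> (\<lambda>x. Var (\<pi> x)))"

definition variants_of :: "('f, 'v) rule set \<Rightarrow> ('f, 'v) rule set" where
  "variants_of R = {\<rho>. \<exists>\<rho>' \<in> R. variant \<rho> \<rho>'}"

definition CP ::
  "('f \<Rightarrow> nat) \<Rightarrow> ('f, 'v) rule set \<Rightarrow> ('f, 'v) rule set \<Rightarrow> ('f, 'v) trm rel" where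
  "CP ar R Q = {(replace_at l2 p r1 \<cdot> \<sigma>, r2 \<cdot> \<sigma>) | l1 r1 l2 r2 p \<sigma>.
     (l1, r1) \<in> variants_of R \<and> (l2, r2) \<in> variants_of Q \<and>
     rule_vars (l1, r1) \<inter> rule_vars (l2, r2) = {} \<and>
     p \<in> poss l2 \<and> \<not> is_Var (subt_at l2 p) \<and>
     is_mgu ar \<sigma> {(l1, subt_at l2 p)} \<and>
     \<not> (p = [] \<and> variant (l1, r1) (l2, r2))}"

text \<open>\<open>is_PCP ar R Q P u v X\<close>: the pair \<open>(u, v)\<close> labelled with the variable set \<open>X\<close> is a
  parallel critical pair arising from an overlap at the set of positions \<open>P\<close>. The list \<open>os\<close>
  consists of the positions \<open>p\<^sub>i\<close> with the rules \<open>(l\<^sub>i, r\<^sub>i)\<close> applied there.\<close>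

definition is_PCP ::
  "('f \<Rightarrow> nat) \<Rightarrow> ('f, 'v) rule set \<Rightarrow> ('f, 'v) rule set \<Rightarrow>
   pos set \<Rightarrow> ('f, 'v) trm \<Rightarrow> ('f, 'v) trm \<Rightarrow> 'v set \<Rightarrow> bool" where
  "is_PCP ar R Q P u v X \<longleftrightarrow>
     (\<exists>(os :: (pos \<times> ('f, 'v) rule) list) l' r' \<sigma>.
        os \<noteq> [] \<and> P = set (map fst os) \<and>
        set (map snd os) \<subseteq> variants_of R \<and> (l', r') \<in> variants_of Q \<and>
        sorted_wrt (\<lambda>\<rho> \<rho>'. rule_vars \<rho> \<inter> rule_vars \<rho>' = {}) ((l', r') # map snd os) \<and>
        sorted_wrt parallel (map fst os) \<and>
        (\<forall>p \<in> P. p \<in> poss l' \<and> \<not> is_Var (subt_at l' p)) \<and>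
        is_mgu ar \<sigma> {(l, subt_at l' p) | p l r. (p, (l, r)) \<in> set os} \<and>
        \<not> (\<exists>\<rho>. os = [([], \<rho>)] \<and> variant \<rho> (l', r')) \<and>
        u = replace_many l' (map (\<lambda>(p, (l, r)). (p, r)) os) \<cdot> \<sigma> \<and>
        v = r' \<cdot> \<sigma> \<and>
        X = vars_at P (l' \<cdot> \<sigma>))"

definition PCP_in ::
  "('f \<Rightarrow> nat) \<Rightarrow> ('f, 'v) rule set \<Rightarrow> ('f, 'v) rule set \<Rightarrow>
   (('f, 'v) trm \<times> ('f, 'v) trm \<times> 'v set) set" where
  "PCP_in ar R Q = {(u, v, X). \<exists>P. [] \<notin> P \<and> is_PCP ar R Q P u v X}"

end

theory Submission
  imports Defs "HOL-Library.Multiset"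
begin

text \<open>
  Since \<open>P\<close> is reversible, it suffices to turn every conversion of \<open>S\<close>-steps and parallel
  \<open>P \<union> P\<inverse>\<close>-steps into \<open>S\<close>-steps, then parallel steps, then converse \<open>S\<close>-steps. Attach to a
  conversion the multiset containing \<open>s\<close> for each \<open>S\<close>-step from \<open>s\<close>, and both ends twice for each
  parallel step. Every peak (an \<open>S\<close>-step meeting an \<open>S\<close>-step or a parallel step) can be replaced by a
  conversion of smaller weight, where terms are compared by the well-founded relation given by
  relative termination. The delicate peak is a parallel step inside an instance of a left-hand
  side \<open>l'\<close> of \<open>S\<close>. As \<open>l'\<close> is linear, the steps not overlapping \<open>l'\<close> act on variables of \<open>l'\<close>
  that the mgu of the parallel critical pair neither moves nor introduces; the variable condition
  in (ii) says that the parallel step joining the pair can be combined with them.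
\<close>

subsection \<open>Substitutions\<close>

text \<open>Moving the non-overlapping steps into the substitution replaces the unifier
  \<open>\<tau>\<close> by some \<open>\<tau>'\<close> that differs from it on part of the
  variables. The instance of the critical pair survives only if
  \<open>\<sigma> x \<cdot> \<tau>' = \<tau>' x\<close> still holds, which \<open>is_mgu\<close>
  alone does not guarantee. Unification therefore yields an mgu that every unifier absorbs, that
  fixes all variables outside the equations and introduces no others. As the hypotheses range over
  all mgus, they apply to this one. Which condition serves a peak depends on the step at the root:
  (iii) if it is the parallel step, (ii) if it is the \<open>S\<close>-step and the parallel step
  lies strictly below, (i) if both steps belong to \<open>S\<close>. So inner parallel critical
  pairs suffice. Reversibility acts at the two ends of the argument: it makes
  \<open>P \<union> P\<inverse>\<close> a TRS, whose rules thus have the same variables on both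
  sides, and it turns the parallel steps between the two descents into
  \<open>P\<close>-steps.\<close>

lemma finite_vars [simp]: "finite (vars t)"
  by (induction t) auto

lemma subst_cong: "(\<And>x. x \<in> vars t \<Longrightarrow> \<sigma> x = \<tau> x) \<Longrightarrow> t \<cdot> \<sigma> = t \<cdot> \<tau>"
  by (induction t) auto

lemma subst_Var [simp]: "t \<cdot> Var = t"
  by (induction t) (auto simp: map_idI)

lemma subst_subst [simp]: "t \<cdot> \<sigma> \<cdot> \<tau> = t \<cdot> (\<lambda>x. \<sigma> x \<cdot> \<tau>)"
  by (induction t) auto

lemma vars_subst: "vars (t \<cdot> \<sigma>) = (\<Union>x \<in> vars t. vars (\<sigma> x))"
  by (induction t) auto

lemma subst_eqD: "t \<cdot> \<sigma> = t \<cdot> \<tau> \<Longrightarrow> x \<in> vars t \<Longrightarrow> \<sigma> x = \<tau> x"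
  by (induction t) auto

lemma wf_subst: "wf_trm ar t \<Longrightarrow> (\<And>x. x \<in> vars t \<Longrightarrow> wf_trm ar (\<sigma> x)) \<Longrightarrow> wf_trm ar (t \<cdot> \<sigma>)"
  by (induction t) auto

lemma is_subst_wf: "is_subst ar \<sigma> \<Longrightarrow> wf_trm ar t \<Longrightarrow> wf_trm ar (t \<cdot> \<sigma>)"
  by (rule wf_subst) (auto simp: is_subst_def)

lemma is_subst_Var [simp]: "is_subst ar Var"
  by (simp add: is_subst_def)

lemma is_subst_comp: "is_subst ar \<sigma> \<Longrightarrow> is_subst ar \<tau> \<Longrightarrow> is_subst ar (\<lambda>x. \<sigma> x \<cdot> \<tau>)"
  unfolding is_subst_def
  by (auto intro: wf_subst intro!: finite_subset[of "{x. \<sigma> x \<cdot> \<tau> \<noteq> Var x}" "{x. \<sigma> x \<noteq> Var x} \<union> {x. \<tau> x \<noteq> Var x}"])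

lemma is_subst_finite_change:
  assumes "is_subst ar \<sigma>" "finite A" "\<And>x. x \<notin> A \<Longrightarrow> \<tau> x = \<sigma> x" "\<And>x. x \<in> A \<Longrightarrow> wf_trm ar (\<tau> x)"
  shows "is_subst ar \<tau>"
proof -
  have "{x. \<tau> x \<noteq> Var x} \<subseteq> {x. \<sigma> x \<noteq> Var x} \<union> A" using assms(3) by auto
  then show ?thesis using assms unfolding is_subst_def
    by (metis (mono_tags) finite_UnI finite_subset)
qed

lemma size_subst_ge: "x \<in> vars t \<Longrightarrow> size (\<tau> x) \<le> size (t \<cdot> \<tau>)"
proof (induction t)
  case (Fun f ts)
  then obtain t where t: "t \<in> set ts" "x \<in> vars t" by auto
  have "size (t \<cdot> \<tau>) \<le> size_list size (map (\<lambda>t. t \<cdot> \<tau>) ts)"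
    using t by (metis (no_types, lifting) dual_order.refl image_eqI image_set size_list_estimation')
  with Fun.IH[OF t] show ?case by simp
qed auto

lemma occurs_check: "x \<in> vars t \<Longrightarrow> t \<noteq> Var x \<Longrightarrow> \<tau> x \<noteq> t \<cdot> \<tau>"
proof (cases t)
  case (Fun f ts)
  assume "x \<in> vars t"
  then obtain t' where t: "t' \<in> set ts" "x \<in> vars t'" using Fun by auto
  have "size (t' \<cdot> \<tau>) \<le> size_list size (map (\<lambda>t. t \<cdot> \<tau>) ts)"
    using t by (metis (no_types, lifting) dual_order.refl image_eqI image_set size_list_estimation')
  then have "size (\<tau> x) < size (t \<cdot> \<tau>)" using size_subst_ge[OF t(2), of \<tau>] Fun by simp
  then show ?thesis by auto
qed auto

subsection \<open>Unification\<close>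

definition eqs_vars :: "(('f, 'v) trm \<times> ('f, 'v) trm) set \<Rightarrow> 'v set" where
  "eqs_vars E = (\<Union>(s, t) \<in> E. vars s \<union> vars t)"

text \<open>The extra unit per equation makes the deletion of a trivial equation decrease the
  measure.\<close>

definition eqs_size :: "(('f, 'v) trm \<times> ('f, 'v) trm) list \<Rightarrow> nat" where
  "eqs_size E = (\<Sum>(s, t) \<leftarrow> E. Suc (size s + size t))"

text \<open>Idempotence is built in: a unifier \<open>\<tau>\<close> factors through
  \<open>\<sigma>\<close> with \<open>\<tau>\<close> itself as second factor, and
  \<open>\<tau>\<close> may have infinite domain. The last two conjuncts confine
  \<open>\<sigma>\<close> to the variables of the equations, so that \<open>\<tau>\<close> can be
  changed on all other variables without losing the factorization.\<close>

definition strong_mgu ::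
  "('f \<Rightarrow> nat) \<Rightarrow> ('f, 'v) subst \<Rightarrow> (('f, 'v) trm \<times> ('f, 'v) trm) set \<Rightarrow> bool" where
  "strong_mgu ar \<sigma> E \<longleftrightarrow> unifies \<sigma> E \<and> (\<forall>\<tau>. unifies \<tau> E \<longrightarrow> (\<forall>x. \<tau> x = \<sigma> x \<cdot> \<tau>)) \<and>
     (\<forall>x. wf_trm ar (\<sigma> x)) \<and> (\<forall>x. x \<notin> eqs_vars E \<longrightarrow> \<sigma> x = Var x) \<and>
     (\<forall>x \<in> eqs_vars E. vars (\<sigma> x) \<subseteq> eqs_vars E)"

lemma finite_eqs_vars [simp]: "finite E \<Longrightarrow> finite (eqs_vars E)"
  by (auto simp: eqs_vars_def)

lemma unifies_subst_swap:
  assumes "\<tau> x = t \<cdot> \<tau>"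
  shows "s \<cdot> (\<lambda>y. (if y = x then t else Var y) \<cdot> \<tau>) = s \<cdot> \<tau>"
  by (rule subst_cong) (use assms in auto)

text \<open>A unifier \<open>\<tau>\<close> of \<open>x\<close> and \<open>t\<close> cannot see the
  elimination of \<open>x\<close>: composing \<open>\<eta> x t\<close> with \<open>\<tau>\<close>
  gives \<open>\<tau>\<close> again. So it also unifies the equations without \<open>x\<close>, and
  their mgu, preceded by \<open>\<eta> x t\<close>, solves the original ones.\<close>

lemma strong_mgu_eliminate:
  fixes E :: "(('f, 'v) trm \<times> ('f, 'v) trm) set"
  defines "\<eta> \<equiv> \<lambda>x (t :: ('f, 'v) trm) y. if y = x then t else Var y"
  assumes "strong_mgu ar \<sigma> ((\<lambda>(u, v). (u \<cdot> \<eta> x t, v \<cdot> \<eta> x t)) ` E)" "wf_trm ar t" "x \<notin> vars t"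
  shows "strong_mgu ar (\<lambda>y. \<eta> x t y \<cdot> \<sigma>) (insert (Var x, t) E)"
proof -
  let ?E' = "(\<lambda>(u, v). (u \<cdot> \<eta> x t, v \<cdot> \<eta> x t)) ` E"
  have tn: "t \<cdot> (\<lambda>y. \<eta> x t y \<cdot> \<sigma>) = t \<cdot> \<sigma>" for \<sigma>
    by (rule subst_cong) (use assms(4) in \<open>auto simp: \<eta>_def\<close>)
  have ve: "eqs_vars ?E' \<subseteq> eqs_vars (insert (Var x, t) E)"
    by (fastforce simp: eqs_vars_def vars_subst \<eta>_def split: if_splits)
  have m: "unifies \<sigma> ?E'" "\<And>\<tau> x. unifies \<tau> ?E' \<Longrightarrow> \<tau> x = \<sigma> x \<cdot> \<tau>" "\<And>x. wf_trm ar (\<sigma> x)"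
    "\<And>x. x \<notin> eqs_vars ?E' \<Longrightarrow> \<sigma> x = Var x" "\<And>x. x \<in> eqs_vars ?E' \<Longrightarrow> vars (\<sigma> x) \<subseteq> eqs_vars ?E'"
    using assms(2) by (auto simp: strong_mgu_def)
  have vs: "vars (\<sigma> y) \<subseteq> eqs_vars (insert (Var x, t) E)" if "y \<in> eqs_vars (insert (Var x, t) E)" for y
    using m(4)[of y] m(5)[of y] ve that by (cases "y \<in> eqs_vars ?E'") auto
  show ?thesis
    unfolding strong_mgu_def
  proof (intro conjI allI impI ballI)
    show "unifies (\<lambda>y. \<eta> x t y \<cdot> \<sigma>) (insert (Var x, t) E)"
      using m(1) tn[of \<sigma>] by (auto simp: unifies_def) (simp add: \<eta>_def)
  next
    fix \<tau> y assume u: "unifies \<tau> (insert (Var x, t) E)"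
    then have e: "\<tau> x = t \<cdot> \<tau>" by (auto simp: unifies_def)
    have "unifies \<tau> ?E'"
      using u unifies_subst_swap[of \<tau> x t, OF e] unfolding unifies_def \<eta>_def by (auto 0 3)
    from m(2)[OF this] have s: "\<And>x. \<sigma> x \<cdot> \<tau> = \<tau> x" by simp
    show "\<tau> y = \<eta> x t y \<cdot> \<sigma> \<cdot> \<tau>" using e by (simp add: s) (simp add: \<eta>_def)
  next
    fix y show "wf_trm ar (\<eta> x t y \<cdot> \<sigma>)"
      using m(3) assms(3) by (auto simp: \<eta>_def intro: wf_subst)
  next
    fix y assume "y \<notin> eqs_vars (insert (Var x, t) E)"
    moreover from this have "y \<noteq> x" by (auto simp: eqs_vars_def)
    ultimately show "\<eta> x t y \<cdot> \<sigma> = Var y" using ve m(4)[of y] by (auto simp: \<eta>_def)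
  next
    fix y assume "y \<in> eqs_vars (insert (Var x, t) E)"
    moreover have "vars t \<subseteq> eqs_vars (insert (Var x, t) E)" by (auto simp: eqs_vars_def)
    ultimately show "vars (\<eta> x t y \<cdot> \<sigma>) \<subseteq> eqs_vars (insert (Var x, t) E)"
      using vs by (auto simp: \<eta>_def vars_subst)
  qed
qed

lemma strong_mgu_cong:
  "strong_mgu ar \<sigma> E \<Longrightarrow> (\<And>\<tau>. unifies \<tau> E \<longleftrightarrow> unifies \<tau> E') \<Longrightarrow> eqs_vars E \<subseteq> eqs_vars E' \<Longrightarrow>
   strong_mgu ar \<sigma> E'"
  unfolding strong_mgu_def
  by (intro conjI allI ballI impI; elim conjE)
    (auto, metis subsetD singletonD trm.set(3))

lemma unifies_insert [simp]: "unifies \<tau> (insert (s, t) E) \<longleftrightarrow> s \<cdot> \<tau> = t \<cdot> \<tau> \<and> unifies \<tau> E"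
  by (auto simp: unifies_def)

lemma eqs_vars_insert [simp]: "eqs_vars (insert (s, t) E) = vars s \<union> vars t \<union> eqs_vars E"
  by (auto simp: eqs_vars_def)

lemma eqs_size_zip:
  "length ss = length ts \<Longrightarrow> eqs_size (zip ss ts) \<le> size_list size ss + size_list size ts"
  by (induction ss ts rule: list_induct2) (auto simp: eqs_size_def)

text \<open>The given unifier \<open>\<tau>\<close> rules out symbol clashes and failing occurs
  checks, and it stays the same throughout the recursion. Elimination removes a variable, while
  deletion and decomposition add none and shrink the size; hence the lexicographic measure.\<close>

lemma strong_mgu_exists:
  assumes "unifies \<tau> (set E)" "\<forall>(s, t) \<in> set E. wf_trm ar s \<and> wf_trm ar t"
  shows "\<exists>\<sigma>. strong_mgu ar \<sigma> (set E)"
  using assms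
proof (induction E rule: wf_induct_rule[OF wf_measures, of "[\<lambda>E. card (eqs_vars (set E)), eqs_size]"])
  case (1 E)
  have elim: ?case if E: "E = (s, t) # E'" and st: "{s, t} = {Var x, u}" and "x \<notin> vars u" for s t x u E'
  proof -
    let ?\<eta> = "\<lambda>y. if y = x then u else Var y"
    let ?E = "map (\<lambda>(a, b). (a \<cdot> ?\<eta>, b \<cdot> ?\<eta>)) E'"
    from st consider "s = Var x" "t = u" | "s = u" "t = Var x" by (auto simp: doubleton_eq_iff)
    then have e: "\<tau> x = u \<cdot> \<tau>" and wu: "wf_trm ar u" and uE': "unifies \<tau> (set E')"
      and vE: "eqs_vars (set E) = insert x (vars u \<union> eqs_vars (set E'))"
      using 1(2,3) unfolding E by (cases; simp; fail)+
    have wE': "\<forall>(s, t) \<in> set E'. wf_trm ar s \<and> wf_trm ar t" using 1(3) unfolding E by simp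
    have v: "vars (a \<cdot> ?\<eta>) \<subseteq> vars u \<union> (vars a - {x})" for a
      by (auto simp: vars_subst split: if_splits)
    have "eqs_vars (set ?E) \<subseteq> eqs_vars (set E) - {x}"
    proof -
      have "eqs_vars (set ?E) = (\<Union>(a, b) \<in> set E'. vars (a \<cdot> ?\<eta>) \<union> vars (b \<cdot> ?\<eta>))"
        unfolding eqs_vars_def by (simp add: case_prod_unfold)
      also have "\<dots> \<subseteq> (\<Union>(a, b) \<in> set E'. vars u \<union> (vars a - {x}) \<union> (vars b - {x}))"
        using v by fast
      also have "\<dots> \<subseteq> vars u \<union> (eqs_vars (set E') - {x})"
        unfolding eqs_vars_def by fast
      finally show ?thesis using that(3) unfolding vE by blast
    qed
    then have "card (eqs_vars (set ?E)) < card (eqs_vars (set E))"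
      by (intro psubset_card_mono) (auto simp: vE)
    then have "(?E, E) \<in> measures [\<lambda>E. card (eqs_vars (set E)), eqs_size]" by simp
    moreover have "unifies \<tau> (set ?E)"
      using uE' unfolding unifies_def by (auto simp: unifies_subst_swap[of \<tau> x u, OF e])
    moreover have "\<forall>(s, t) \<in> set ?E. wf_trm ar s \<and> wf_trm ar t"
      using wE' wu by (auto intro!: wf_subst)
    ultimately obtain \<sigma> where "strong_mgu ar \<sigma> (set ?E)" using 1(1) by presburger
    then have m: "strong_mgu ar (\<lambda>y. ?\<eta> y \<cdot> \<sigma>) (insert (Var x, u) (set E'))"
      using strong_mgu_eliminate[of ar \<sigma> x u "set E'"] wu that(3) by simp
    have "strong_mgu ar (\<lambda>y. ?\<eta> y \<cdot> \<sigma>) (set E)"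
    proof (rule strong_mgu_cong[OF m])
      show "unifies \<rho> (insert (Var x, u) (set E')) \<longleftrightarrow> unifies \<rho> (set E)" for \<rho>
        using st unfolding E doubleton_eq_iff by (elim disjE conjE) (simp_all add: eq_commute)
      show "eqs_vars (insert (Var x, u) (set E')) \<subseteq> eqs_vars (set E)"
        unfolding vE by simp
    qed
    then show ?thesis by blast
  qed
  have smaller: "\<exists>\<sigma>. strong_mgu ar \<sigma> (set F)"
    if "eqs_vars (set F) \<subseteq> eqs_vars (set E)" "eqs_size F < eqs_size E" "unifies \<tau> (set F)"
      "\<forall>(s, t) \<in> set F. wf_trm ar s \<and> wf_trm ar t" for F
  proof -
    have "card (eqs_vars (set F)) \<le> card (eqs_vars (set E))" using that(1) by (intro card_mono) auto
    then have "card (eqs_vars (set F)) < card (eqs_vars (set E)) \<or>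
      card (eqs_vars (set F)) = card (eqs_vars (set E))" by linarith
    then have "(F, E) \<in> measures [\<lambda>E. card (eqs_vars (set E)), eqs_size]"
      using that(2) by auto
    then show ?thesis by (rule 1(1)) (rule that)+
  qed
  show ?case
  proof (cases E)
    case Nil
    have "strong_mgu ar Var (set E)" unfolding Nil by (simp add: strong_mgu_def unifies_def)
    then show ?thesis by blast
  next
    case (Cons e E')
    obtain s t where "e = (s, t)" by force
    with Cons have E: "E = (s, t) # E'" by simp
    have eq: "s \<cdot> \<tau> = t \<cdot> \<tau>" and uE': "unifies \<tau> (set E')"
      and wE': "\<forall>(s, t) \<in> set E'. wf_trm ar s \<and> wf_trm ar t"
      and wst: "wf_trm ar s" "wf_trm ar t"
      using 1(2,3) unfolding E by simp_all
    consider (same) x where "s = Var x" "t = Var x"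
      | (v1) x where "s = Var x" "t \<noteq> Var x"
      | (v2) x where "t = Var x" "s \<noteq> Var x"
      | (ff) f ss g ts where "s = Fun f ss" "t = Fun g ts"
      by (metis trm.exhaust)
    then show ?thesis
    proof cases
      case same
      have "eqs_vars (set E') \<subseteq> eqs_vars (set E)" "eqs_size E' < eqs_size E"
        unfolding E by (auto simp: eqs_size_def)
      from smaller[OF this uE' wE'] obtain \<sigma> where m: "strong_mgu ar \<sigma> (set E')" ..
      have "strong_mgu ar \<sigma> (set E)"
        by (rule strong_mgu_cong[OF m]) (auto simp: E same)
      then show ?thesis by blast
    next
      case v1
      show ?thesis
      proof (rule elim[OF E])
        show "{s, t} = {Var x, t}" using v1 by simp
        show "x \<notin> vars t" using occurs_check[of x t \<tau>] eq v1 by auto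
      qed
    next
      case v2
      show ?thesis
      proof (rule elim[OF E])
        show "{s, t} = {Var x, s}" using v2 by auto
        show "x \<notin> vars s" using occurs_check[of x s \<tau>] eq v2 by auto
      qed
    next
      case ff
      with eq have gf: "g = f" and m: "map (\<lambda>t. t \<cdot> \<tau>) ss = map (\<lambda>t. t \<cdot> \<tau>) ts" by auto
      from m have len: "length ss = length ts" by (metis length_map)
      let ?E = "zip ss ts @ E'"
      have zip: "unifies \<rho> (set (zip ss ts)) \<longleftrightarrow> map (\<lambda>t. t \<cdot> \<rho>) ss = map (\<lambda>t. t \<cdot> \<rho>) ts" for \<rho>
        using len by (induction ss ts rule: list_induct2) (simp_all, simp add: unifies_def)
      have uz: "unifies \<rho> (set ?E) \<longleftrightarrow> unifies \<rho> (set E)" for \<rho>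
        using zip[of \<rho>] unfolding E ff gf by (auto simp: unifies_def)
      have "eqs_vars (set (zip ss ts)) = (\<Union>s \<in> set ss. vars s) \<union> (\<Union>t \<in> set ts. vars t)"
        using len by (induction ss ts rule: list_induct2) (auto simp: eqs_vars_def)
      then have v: "eqs_vars (set ?E) = eqs_vars (set E)"
        unfolding E ff by (auto simp: eqs_vars_def)
      have sz: "eqs_size ?E < eqs_size E"
        using eqs_size_zip[OF len] unfolding E ff by (simp add: eqs_size_def)
      have "\<forall>(s, t) \<in> set ?E. wf_trm ar s \<and> wf_trm ar t"
        using wE' wst unfolding ff by (auto dest: set_zip_leftD set_zip_rightD)
      from smaller[OF equalityD1[OF v] sz _ this] 1(2) uz[of \<tau>]
      obtain \<sigma> where m: "strong_mgu ar \<sigma> (set ?E)" by auto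
      have "strong_mgu ar \<sigma> (set E)"
        by (rule strong_mgu_cong[OF m uz equalityD1[OF v]])
      then show ?thesis by blast
    qed
  qed
qed

lemma strong_mgu_is_mgu:
  assumes "strong_mgu ar \<sigma> E" "finite E"
  shows "is_mgu ar \<sigma> E" and "is_subst ar \<sigma>"
proof -
  show "is_subst ar \<sigma>"
    by (rule is_subst_finite_change[OF is_subst_Var, of "eqs_vars E"])
      (use assms in \<open>auto simp: strong_mgu_def\<close>)
  then show "is_mgu ar \<sigma> E" using assms(1) unfolding is_mgu_def strong_mgu_def by blast
qed

subsection \<open>Church-Rosser modulo a symmetric relation\<close>

text \<open>In the application, \<open>A\<close> is rewriting by \<open>S\<close>, \<open>B\<close>
  rewriting by \<open>P'\<close>, and \<open>H\<close> the parallel relation. \<open>B\<close> is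
  kept apart from \<open>H\<close> because termination holds relative to \<open>B\<close> only. In
  the second alternative of \<open>peak_HA\<close> the side of \<open>u\<close> starts with a
  genuine \<open>A\<close>-step, which puts everything after it below \<open>u\<close>.\<close>

locale peaks =
  fixes A B H :: "'a rel"
  assumes wf_rel: "wf ((A O B\<^sup>*)\<inverse>)"
    and B_H: "B \<subseteq> H" and sym_H: "sym H"
    and peak_AA: "(t, u) \<in> A \<Longrightarrow> (t, v) \<in> A \<Longrightarrow>
      \<exists>a b. (u, a) \<in> (A \<union> B)\<^sup>* \<and> (v, b) \<in> (A \<union> B)\<^sup>* \<and> (a, b) \<in> H"
    and peak_HA: "(t, u) \<in> H \<Longrightarrow> (t, v) \<in> A \<Longrightarrow>
      (\<exists>b. (v, b) \<in> (A \<union> B)\<^sup>* \<and> (b, u) \<in> H) \<or>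
      (\<exists>u' a b. (u, u') \<in> A \<and> (u', a) \<in> (A \<union> B)\<^sup>* \<and> (v, b) \<in> (A \<union> B)\<^sup>* \<and> (b, a) \<in> H)"
begin

text \<open>The \<open>B\<close>-steps come after the \<open>A\<close>-step, so whatever is below
  \<open>t\<close> stays below \<open>t\<close> along \<open>B\<close>. Transitivity serves chains
  of \<open>A\<close>-steps and the decomposition of multiset comparisons.\<close>

definition lt :: "'a rel" where
  "lt = ((A O B\<^sup>*)\<inverse>)\<^sup>+"

text \<open>The weight of an \<open>H\<close>-step counts both ends twice: when a peak \<open>u H t A v\<close> is
  replaced by a conversion starting with an \<open>A\<close>-step from \<open>u\<close>, one copy of \<open>u\<close> is used up by
  that step and the other one dominates the elements below \<open>u\<close>.\<close>

inductive conv :: "'a \<Rightarrow> 'a \<Rightarrow> 'a multiset \<Rightarrow> bool" where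
  refl: "conv s s {#}"
| fwd: "(s, t) \<in> A \<Longrightarrow> conv t u M \<Longrightarrow> conv s u ({#s#} + M)"
| bwd: "(t, s) \<in> A \<Longrightarrow> conv t u M \<Longrightarrow> conv s u ({#t#} + M)"
| eqv: "(s, t) \<in> H \<Longrightarrow> conv t u M \<Longrightarrow> conv s u ({#s, s, t, t#} + M)"

lemma wf_lt: "wf lt"
  unfolding lt_def using wf_rel by (rule wf_trancl)

lemma trans_lt: "trans lt"
  by (simp add: lt_def)

lemma conv_trans: "conv s t M \<Longrightarrow> conv t u N \<Longrightarrow> conv s u (M + N)"
proof (induction rule: conv.induct)
  case (fwd s t u M) then show ?case using conv.fwd by (metis add.assoc)
next
  case (bwd s t u M) then show ?case using conv.bwd by (metis add.assoc)
next
  case (eqv s t u M) then show ?case using conv.eqv by (metis add.assoc)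
qed simp

lemma conv_singles:
  "(s, t) \<in> A \<Longrightarrow> conv s t {#s#}" "(t, s) \<in> A \<Longrightarrow> conv s t {#t#}" "(s, t) \<in> H \<Longrightarrow> conv s t {#s, s, t, t#}"
  using fwd[OF _ refl] bwd[OF _ refl] eqv[OF _ refl] by force+

lemma conv_sym: "conv s t M \<Longrightarrow> conv t s M"
proof (induction rule: conv.induct)
  case (fwd s t u M)
  then show ?case using conv_trans[OF _ conv_singles(2)[of s t]] by (simp add: add.commute)
next
  case (bwd t s u M)
  then show ?case using conv_trans[OF _ conv_singles(1)[of t s]] by (simp add: add.commute)
next
  case (eqv s t u M)
  then have "(t, s) \<in> H" using sym_H by (meson symD)
  then show ?case using conv_trans[OF eqv.IH conv_singles(3)[of t s]]
    by (simp add: add_mset_commute)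
qed (rule conv.refl)

lemma A_lt: "(t, v) \<in> A \<Longrightarrow> (v, t) \<in> lt"
  unfolding lt_def by (rule r_into_trancl) auto

lemma lt_B: "(v, t) \<in> lt \<Longrightarrow> (v, w) \<in> B \<Longrightarrow> (w, t) \<in> lt"
proof -
  assume vt: "(v, t) \<in> lt" and b: "(v, w) \<in> B"
  have "(v, t) \<in> ((A O B\<^sup>*)\<inverse>)\<^sup>+" using vt by (simp add: lt_def)
  then obtain x where "(v, x) \<in> (A O B\<^sup>*)\<inverse>" "(x, t) \<in> ((A O B\<^sup>*)\<inverse>)\<^sup>*"
    by (meson tranclD)
  moreover from this b have "(w, x) \<in> (A O B\<^sup>*)\<inverse>"
    by (auto intro: rtrancl_into_rtrancl)
  ultimately show ?thesis unfolding lt_def by (meson rtrancl_into_trancl2)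
qed

text \<open>A \<open>B\<close>-step enters the conversion as an \<open>H\<close>-step and
  contributes both ends twice; this is harmless, because both ends are below
  \<open>t\<close>.\<close>

lemma conv_below:
  assumes "(v, w) \<in> (A \<union> B)\<^sup>*" "(v, t) \<in> lt"
  shows "(w, t) \<in> lt \<and> (\<exists>M. conv v w M \<and> (\<forall>x \<in># M. (x, t) \<in> lt))"
  using assms
proof (induction rule: rtrancl_induct)
  case base
  then show ?case using conv.refl by fastforce
next
  case (step y z)
  then obtain M where y: "(y, t) \<in> lt" and M: "conv v y M" "\<forall>x \<in># M. (x, t) \<in> lt" by auto
  from step(2) show ?case
  proof
    assume "(y, z) \<in> A"
    moreover from this y have "(z, t) \<in> lt" using A_lt trans_lt by (meson transD)
    ultimately show ?thesis using conv_trans[OF M(1) conv_singles(1)] M(2) y by fastforce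
  next
    assume "(y, z) \<in> B"
    moreover from this y have "(z, t) \<in> lt" using lt_B by blast
    ultimately show ?thesis using conv_trans[OF M(1) conv_singles(3)[of y z]] M(2) y B_H by fastforce
  qed
qed

lemma peak_AA_conv:
  assumes "(t, u) \<in> A" "(t, v) \<in> A"
  shows "\<exists>M. conv u v M \<and> (M, {#t, t#}) \<in> mult lt"
proof -
  obtain a b where ab: "(u, a) \<in> (A \<union> B)\<^sup>*" "(v, b) \<in> (A \<union> B)\<^sup>*" "(a, b) \<in> H"
    using peak_AA assms by blast
  from conv_below[OF ab(1) A_lt[OF assms(1)]] obtain M where
    M: "(a, t) \<in> lt" "conv u a M" "\<forall>x \<in># M. (x, t) \<in> lt" by blast
  from conv_below[OF ab(2) A_lt[OF assms(2)]] obtain N where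
    N: "(b, t) \<in> lt" "conv v b N" "\<forall>x \<in># N. (x, t) \<in> lt" by blast
  have "conv u v (M + ({#a, a, b, b#} + N))"
    using M(2) conv_singles(3)[OF ab(3)] conv_sym[OF N(2)] by (meson conv_trans)
  moreover have "({#} + (M + ({#a, a, b, b#} + N)), {#} + {#t, t#}) \<in> mult lt"
    by (rule one_step_implies_mult) (use M N in auto)
  ultimately show ?thesis by auto
qed

lemma peak_HA_conv:
  assumes "(t, u) \<in> H" "(t, v) \<in> A"
  shows "\<exists>M. conv u v M \<and> (M, {#u, u, t, t, t#}) \<in> mult lt"
  using peak_HA[OF assms]
proof (elim disjE exE conjE)
  fix b assume b: "(v, b) \<in> (A \<union> B)\<^sup>*" "(b, u) \<in> H"
  from conv_below[OF b(1) A_lt[OF assms(2)]] obtain N where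
    N: "(b, t) \<in> lt" "conv v b N" "\<forall>x \<in># N. (x, t) \<in> lt" by blast
  have "conv v u (N + {#b, b, u, u#})"
    using N(2) conv_singles(3)[OF b(2)] by (rule conv_trans)
  \<comment> \<open>\<open>u\<close> need not be below \<open>t\<close>. The two copies of
    \<open>u\<close> from the new \<open>H\<close>-step are matched with the two in the old peak,
    and \<open>t\<close> dominates the rest.\<close>
  moreover have "({#u, u#} + ({#b, b#} + N), {#u, u#} + {#t, t, t#}) \<in> mult lt"
    by (rule one_step_implies_mult) (use N in auto)
  moreover have "N + {#b, b, u, u#} = {#u, u#} + ({#b, b#} + N)"
    "{#u, u, t, t, t#} = {#u, u#} + {#t, t, t#}"
    by (simp_all add: add_mset_commute)
  ultimately show ?thesis using conv_sym by metis
next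
  fix u' a b
  assume *: "(u, u') \<in> A" "(u', a) \<in> (A \<union> B)\<^sup>*" "(v, b) \<in> (A \<union> B)\<^sup>*" "(b, a) \<in> H"
  from conv_below[OF *(3) A_lt[OF assms(2)]] obtain N where
    N: "(b, t) \<in> lt" "conv v b N" "\<forall>x \<in># N. (x, t) \<in> lt" by blast
  from conv_below[OF *(2) A_lt[OF *(1)]] obtain M where
    M: "(a, u) \<in> lt" "conv u' a M" "\<forall>x \<in># M. (x, u) \<in> lt" by blast
  have "conv v u (N + ({#b, b, a, a#} + (M + {#u#})))"
    using N(2) conv_singles(3)[OF *(4)] conv_sym[OF M(2)] conv_singles(2)[OF *(1)]
    by (meson conv_trans)
  moreover have "({#u#} + (N + ({#b, b, a, a#} + M)), {#u#} + {#u, t, t, t#}) \<in> mult lt"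
    by (rule one_step_implies_mult) (use N M in auto)
  moreover have "N + ({#b, b, a, a#} + (M + {#u#})) = {#u#} + (N + ({#b, b, a, a#} + M))"
    "{#u, u, t, t, t#} = {#u#} + {#u, t, t, t#}"
    by (simp_all add: add_mset_commute)
  ultimately show ?thesis using conv_sym by metis
qed

definition reducible :: "'a \<Rightarrow> 'a \<Rightarrow> 'a multiset \<Rightarrow> bool" where
  "reducible s t M \<longleftrightarrow> (\<exists>N. conv s t N \<and> (N, M) \<in> mult lt)"

lemma mult_mono_right: "(N, M) \<in> mult lt \<Longrightarrow> (K + N, K + M) \<in> mult lt"
proof -
  assume "(N, M) \<in> mult lt"
  from mult_implies_one_step[OF trans_lt this] obtain I J L where
    "M = I + J" "N = I + L" "J \<noteq> {#}" "\<forall>k \<in># L. \<exists>j \<in># J. (k, j) \<in> lt" by blast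
  then show ?thesis using one_step_implies_mult[of J L lt "K + I"] by (simp add: add.assoc)
qed

lemma reducible_context:
  assumes "conv s x K" "reducible x t M" shows "reducible s t (K + M)"
  using assms mult_mono_right conv_trans unfolding reducible_def by meson

lemma reducible_append:
  assumes "reducible s x M" "conv x t K" shows "reducible s t (M + K)"
  using assms mult_mono_right conv_trans unfolding reducible_def by (metis add.commute)

definition valley :: "'a rel" where
  "valley = A\<^sup>* O H\<^sup>* O (A\<inverse>)\<^sup>*"

lemma up_valley: "(s, t) \<in> (A\<inverse>)\<^sup>* \<Longrightarrow> (s, t) \<in> valley"
  unfolding valley_def by blast

lemma eq_valley: "(s, s') \<in> H \<Longrightarrow> (s', t) \<in> H\<^sup>* O (A\<inverse>)\<^sup>* \<Longrightarrow> (s, t) \<in> valley"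
  unfolding valley_def by (meson converse_rtrancl_into_rtrancl relcomp.cases relcompI rtrancl.rtrancl_refl)

lemma down_valley: "(s, s') \<in> A \<Longrightarrow> (s', t) \<in> valley \<Longrightarrow> (s, t) \<in> valley"
  unfolding valley_def by (meson converse_rtrancl_into_rtrancl relcomp.cases relcompI)

text \<open>In a conversion without peaks, the tail after an \<open>A\<inverse>\<close>-step consists of \<open>A\<inverse>\<close>-steps and
  the tail after an \<open>H\<close>-step contains no \<open>A\<close>-step; only the first step has to be remembered.\<close>

lemma conv_cases:
  assumes "conv s t M"
  shows "reducible s t M \<or> (s, t) \<in> (A\<inverse>)\<^sup>* \<or>
    (\<exists>s' K. M = {#s, s, s', s'#} + K \<and> (s, s') \<in> H \<and> conv s' t K \<and> (s', t) \<in> H\<^sup>* O (A\<inverse>)\<^sup>*) \<or>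
    (\<exists>s' K. M = {#s#} + K \<and> (s, s') \<in> A \<and> conv s' t K \<and> (s', t) \<in> valley)"
    (is "?red s t M \<or> ?up s t \<or> ?eq s t M \<or> ?down s t M")
  using assms
proof (induction rule: conv.induct)
  case (fwd s s1 t M)
  have "(s1, t) \<in> valley" if "\<not> ?red s1 t M"
    using fwd.IH that up_valley eq_valley down_valley by blast
  moreover have "?red s t ({#s#} + M)" if "?red s1 t M"
    using reducible_context[OF conv_singles(1)[OF fwd(1)] that] .
  ultimately show ?case using fwd(1,2) by blast
next
  case (bwd s1 s t M)
  from bwd.IH show ?case
  proof (elim disjE)
    assume "?red s1 t M"
    then show ?thesis using reducible_context[OF conv_singles(2)[OF bwd(1)]] by blast
  next
    assume "?up s1 t"
    then show ?thesis using bwd(1) by (meson converseI converse_rtrancl_into_rtrancl)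
  next
    assume "?eq s1 t M"
    then obtain s' K where *: "M = {#s1, s1, s', s'#} + K" "(s1, s') \<in> H" "conv s' t K" by blast
    \<comment> \<open>The prepended step creates a peak at \<open>s1\<close>; it is replaced by a
      lighter conversion and the tail \<open>K\<close> is attached again.\<close>
    from peak_HA_conv[OF *(2) bwd(1)] have "reducible s s' {#s', s', s1, s1, s1#}"
      unfolding reducible_def using conv_sym by blast
    from reducible_append[OF this *(3)] have "reducible s t ({#s1#} + M)"
      unfolding *(1) by (simp add: add_mset_commute)
    then show ?thesis by blast
  next
    assume "?down s1 t M"
    then obtain s' K where *: "M = {#s1#} + K" "(s1, s') \<in> A" "conv s' t K" by blast
    from peak_AA_conv[OF bwd(1) *(2)] have "reducible s s' {#s1, s1#}"
      unfolding reducible_def by blast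
    from reducible_append[OF this *(3)] have "reducible s t ({#s1#} + M)"
      unfolding *(1) by simp
    then show ?thesis by blast
  qed
next
  case (eqv s s1 t M)
  from eqv.IH show ?case
  proof (elim disjE)
    assume "?red s1 t M"
    then show ?thesis using reducible_context[OF conv_singles(3)[OF eqv(1)]] by blast
  next
    assume "?up s1 t"
    then show ?thesis using eqv(1,2) by blast
  next
    assume "?eq s1 t M"
    then have "(s1, t) \<in> H\<^sup>* O (A\<inverse>)\<^sup>*" by (auto intro: converse_rtrancl_into_rtrancl)
    then show ?thesis using eqv(1,2) by blast
  next
    assume "?down s1 t M"
    then obtain s' K where *: "M = {#s1#} + K" "(s1, s') \<in> A" "conv s' t K" by blast
    have "(s1, s) \<in> H" using sym_H eqv(1) by (meson symD)
    from peak_HA_conv[OF this *(2)] have "reducible s s' {#s, s, s1, s1, s1#}"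
      unfolding reducible_def by blast
    from reducible_append[OF this *(3)] have "reducible s t ({#s, s, s1, s1#} + M)"
      unfolding *(1) by (simp add: add_mset_commute)
    then show ?thesis by blast
  qed
qed simp

text \<open>Induction on the weight with both ends fixed: a reducible conversion gives way to a
  lighter one between the same terms, and the other cases of \<open>conv_cases\<close> are valleys
  already.\<close>

lemma conv_valley: "conv s t M \<Longrightarrow> (s, t) \<in> valley"
proof (induction M arbitrary: rule: wf_induct_rule[OF wf_mult[OF wf_lt]])
  case (1 M)
  from conv_cases[OF 1(2)] show ?case
  proof (elim disjE)
    assume "reducible s t M"
    then show ?thesis using 1(1) unfolding reducible_def by blast
  qed (use up_valley eq_valley down_valley in blast)+
qed

theorem church_rosser_modulo: "(A \<union> A\<inverse> \<union> H)\<^sup>* \<subseteq> A\<^sup>* O H\<^sup>* O (A\<inverse>)\<^sup>*"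
proof
  fix p assume "p \<in> (A \<union> A\<inverse> \<union> H)\<^sup>*"
  moreover obtain s t where p: "p = (s, t)" by force
  ultimately have "(s, t) \<in> (A \<union> A\<inverse> \<union> H)\<^sup>*" by simp
  then have "\<exists>M. conv s t M"
    by (induction rule: converse_rtrancl_induct) (blast intro: conv.intros)+
  then show "p \<in> A\<^sup>* O H\<^sup>* O (A\<inverse>)\<^sup>*" using conv_valley p by (auto simp: valley_def)
qed

end

subsection \<open>Rewriting and parallel rewriting without positions\<close>

lemma is_trsD:
  assumes "is_trs ar R" "(l, r) \<in> R"
  shows "wf_trm ar l" "wf_trm ar r" "\<not> is_Var l" "vars r \<subseteq> vars l"
  using assms by (auto simp: is_trs_def)

text \<open>Recursion along the context replaces positions, so that peaks can be analysed by
  induction. Well-formedness of the terms is left out; it is put back on the return to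
  \<open>rstep\<close>.\<close>

inductive rew :: "('f \<Rightarrow> nat) \<Rightarrow> ('f, 'v) rule set \<Rightarrow> ('f, 'v) trm \<Rightarrow> ('f, 'v) trm \<Rightarrow> bool"
  for ar R where
  root: "(l, r) \<in> R \<Longrightarrow> is_subst ar \<sigma> \<Longrightarrow> rew ar R (l \<cdot> \<sigma>) (r \<cdot> \<sigma>)"
| arg: "rew ar R (ts ! i) u \<Longrightarrow> i < length ts \<Longrightarrow> rew ar R (Fun f ts) (Fun f (ts[i := u]))"

text \<open>All contracta have their variables in \<open>X\<close>; \<open>X = UNIV\<close> gives ordinary parallel rewriting.\<close>

inductive par ::
  "('f \<Rightarrow> nat) \<Rightarrow> ('f, 'v) rule set \<Rightarrow> 'v set \<Rightarrow> ('f, 'v) trm \<Rightarrow> ('f, 'v) trm \<Rightarrow> bool"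
  for ar R X where
  var: "par ar R X (Var x) (Var x)"
| root: "(l, r) \<in> R \<Longrightarrow> is_subst ar \<theta> \<Longrightarrow> vars (r \<cdot> \<theta>) \<subseteq> X \<Longrightarrow> par ar R X (l \<cdot> \<theta>) (r \<cdot> \<theta>)"
| args: "length us = length ts \<Longrightarrow> (\<And>i. i < length ts \<Longrightarrow> par ar R X (ts ! i) (us ! i)) \<Longrightarrow>
    par ar R X (Fun f ts) (Fun f us)"

lemma par_refl: "par ar R X t t"
  by (induction t) (auto intro: par.intros)

lemma par_sym: "par ar R UNIV s t \<Longrightarrow> R\<inverse> = R \<Longrightarrow> par ar R UNIV t s"
  by (induction rule: par.induct) (auto intro!: par.intros)

lemma par_update: "par ar R X (ts ! i) u \<Longrightarrow> i < length ts \<Longrightarrow> par ar R X (Fun f ts) (Fun f (ts[i := u]))"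
  by (rule par.args) (auto simp: nth_list_update par_refl)

lemma rew_par: "rew ar R s t \<Longrightarrow> par ar R UNIV s t"
  by (induction rule: rew.induct) (auto intro: par.root par_update)

lemma rew_mono: "rew ar R s t \<Longrightarrow> R \<subseteq> R' \<Longrightarrow> rew ar R' s t"
  by (induction rule: rew.induct) (auto intro: rew.intros)

lemma rews_mono: "(rew ar R)\<^sup>*\<^sup>* s t \<Longrightarrow> R \<subseteq> R' \<Longrightarrow> (rew ar R')\<^sup>*\<^sup>* s t"
  by (metis mono_rtranclp rew_mono)

text \<open>Redex and contractum are both well-formed whatever the context, so well-formedness of
  either term is a matter of the common context alone.\<close>

lemma rew_wf: "rew ar R s t \<Longrightarrow> is_trs ar R \<Longrightarrow> wf_trm ar s \<longleftrightarrow> wf_trm ar t"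
proof (induction rule: rew.induct)
  case (arg ts i u f)
  then show ?case by (auto simp: all_set_conv_all_nth nth_list_update)
qed (auto simp: is_subst_wf is_trsD)

lemma rews_wf: "(rew ar R)\<^sup>*\<^sup>* s t \<Longrightarrow> is_trs ar R \<Longrightarrow> wf_trm ar s \<longleftrightarrow> wf_trm ar t"
  by (induction rule: rtranclp_induct) (auto dest: rew_wf)

lemma par_wf: "par ar R X s t \<Longrightarrow> is_trs ar R \<Longrightarrow> wf_trm ar s \<longleftrightarrow> wf_trm ar t"
proof (induction rule: par.induct)
  case (args us ts f)
  then show ?case by (auto simp: all_set_conv_all_nth)
qed (auto simp: is_subst_wf is_trsD)

lemma rew_vars: "rew ar R s t \<Longrightarrow> is_trs ar R \<Longrightarrow> vars t \<subseteq> vars s"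
proof (induction rule: rew.induct)
  case (root l r \<sigma>)
  then show ?case using is_trsD(4) by (fastforce simp: vars_subst)
next
  case (arg ts i u f)
  then show ?case by (auto simp: in_set_conv_nth nth_list_update split: if_splits) force+
qed

lemma rews_arg:
  "(rew ar R)\<^sup>*\<^sup>* (ts ! i) u \<Longrightarrow> i < length ts \<Longrightarrow> (rew ar R)\<^sup>*\<^sup>* (Fun f ts) (Fun f (ts[i := u]))"
proof (induction rule: rtranclp_induct)
  case (step y z)
  then have "rew ar R (Fun f (ts[i := y])) (Fun f (ts[i := y, i := z]))" by (intro rew.arg) auto
  then show ?case using step by simp
qed simp

lemma rews_args:
  assumes "length us = length ts" "\<And>i. i < length ts \<Longrightarrow> (rew ar R)\<^sup>*\<^sup>* (ts ! i) (us ! i)"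
  shows "(rew ar R)\<^sup>*\<^sup>* (Fun f ts) (Fun f us)"
proof -
  \<comment> \<open>The arguments are treated from left to right; the first \<open>k\<close> are
    already those of \<open>us\<close>.\<close>
  have "(rew ar R)\<^sup>*\<^sup>* (Fun f ts) (Fun f (take k us @ drop k ts))" if "k \<le> length ts" for k
    using that
  proof (induction k)
    case (Suc k)
    let ?ts = "take k us @ drop k ts"
    have "(rew ar R)\<^sup>*\<^sup>* (Fun f ?ts) (Fun f (?ts[k := us ! k]))"
      by (rule rews_arg) (use Suc.prems assms in \<open>auto simp: nth_append\<close>)
    moreover have "?ts[k := us ! k] = take (Suc k) us @ drop (Suc k) ts"
      using Suc.prems assms(1)
      by (simp add: list_update_append take_Suc_conv_app_nth) (metis Cons_nth_drop_Suc Suc_le_lessD list_update_code(2))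
    ultimately show ?case using Suc by simp
  qed simp
  from this[of "length ts"] show ?thesis using assms(1) by simp
qed

lemma rew_subst:
  "rew ar R s t \<Longrightarrow> is_subst ar \<delta> \<Longrightarrow> rew ar R (s \<cdot> \<delta>) (t \<cdot> \<delta>)"
proof (induction rule: rew.induct)
  case (root l r \<sigma>)
  then show ?case using rew.root[OF root(1) is_subst_comp[OF root(2,3)]] by simp
next
  case (arg ts i u f)
  then show ?case using rew.arg[of ar R "map (\<lambda>t. t \<cdot> \<delta>) ts" i "u \<cdot> \<delta>" f]
    by (simp add: map_update)
qed

lemma rews_subst:
  "(rew ar R)\<^sup>*\<^sup>* s t \<Longrightarrow> is_subst ar \<delta> \<Longrightarrow> (rew ar R)\<^sup>*\<^sup>* (s \<cdot> \<delta>) (t \<cdot> \<delta>)"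
  by (induction rule: rtranclp_induct) (auto dest: rew_subst intro: rtranclp.rtrancl_into_rtrancl)

lemma par_rews: "par ar R X s t \<Longrightarrow> (rew ar R)\<^sup>*\<^sup>* s t"
  by (induction rule: par.induct) (auto intro: rew.root rews_args)

lemma par_subst_refl: "(\<And>x. par ar R X (\<delta> x) (\<delta>' x)) \<Longrightarrow> par ar R X (t \<cdot> \<delta>) (t \<cdot> \<delta>')"
  by (induction t) (auto intro: par.args)

text \<open>This is the use of the variable condition in (ii). The contracta contain only variables
  of \<open>X\<close>, where \<open>\<delta>\<close> and \<open>\<delta>'\<close> agree, so the
  steps from \<open>\<delta>\<close> to \<open>\<delta>'\<close> leave them alone. Elsewhere these
  steps occur at positions parallel to the contracted ones, and everything fits into one parallel
  step.\<close>

lemma par_subst: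
  assumes "par ar R X s t" "is_subst ar \<delta>"
    and "\<And>x. par ar R UNIV (\<delta> x) (\<delta>' x)" "\<And>x. x \<in> X \<Longrightarrow> \<delta>' x = \<delta> x"
  shows "par ar R UNIV (s \<cdot> \<delta>) (t \<cdot> \<delta>')"
  using assms(1)
proof (induction rule: par.induct)
  case (var x)
  then show ?case using assms(3) by simp
next
  case (root l r \<theta>)
  have "r \<cdot> \<theta> \<cdot> \<delta>' = r \<cdot> \<theta> \<cdot> \<delta>"
    by (rule subst_cong) (use assms(4) root in auto)
  then show ?case using par.root[OF root(1) is_subst_comp[OF root(2) assms(2)], of UNIV] by simp
next
  case (args us ts f)
  then show ?case by (auto intro: par.args)
qed

lemma par_UNIV_subst:
  "par ar R UNIV s t \<Longrightarrow> is_subst ar \<delta> \<Longrightarrow> par ar R UNIV (s \<cdot> \<delta>) (t \<cdot> \<delta>)"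
  by (rule par_subst) (auto simp: par_refl)

section \<open>Translation between \<open>rew\<close> and rewriting at positions\<close>

lemma rew_subterm_step:
  "p \<in> poss s \<Longrightarrow> subt_at s p = l \<cdot> \<sigma> \<Longrightarrow> (l, r) \<in> R \<Longrightarrow> is_subst ar \<sigma> \<Longrightarrow>
   rew ar R s (replace_at s p (r \<cdot> \<sigma>))"
proof (induction s arbitrary: p)
  case (Var x)
  then show ?case using rew.root[of l r R ar \<sigma>] by simp
next
  case (Fun f ts)
  show ?case
  proof (cases p)
    case Nil
    then show ?thesis using rew.root[of l r R ar \<sigma>] Fun by simp
  next
    case (Cons i q)
    then obtain j where "i = Suc j" "j < length ts" "q \<in> poss (ts ! j)" using Fun.prems(1) by auto
    then show ?thesis using Fun Cons by (auto intro!: rew.arg)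
  qed
qed

lemma rstep_rew: "(s, t) \<in> rstep ar R \<Longrightarrow> rew ar R s t"
  unfolding rstep_def by (auto intro: rew_subterm_step)

lemma rsteps_rews: "(s, t) \<in> (rstep ar R)\<^sup>* \<Longrightarrow> (rew ar R)\<^sup>*\<^sup>* s t"
  by (induction rule: rtrancl_induct) (auto dest: rstep_rew intro: rtranclp.rtrancl_into_rtrancl)

lemma rew_position:
  "rew ar R s t \<Longrightarrow> \<exists>l r \<sigma> p. (l, r) \<in> R \<and> is_subst ar \<sigma> \<and> p \<in> poss s \<and>
     subt_at s p = l \<cdot> \<sigma> \<and> t = replace_at s p (r \<cdot> \<sigma>)"
proof (induction rule: rew.induct)
  case (root l r \<sigma>)
  have "[] \<in> poss (l \<cdot> \<sigma>)" by (cases "l \<cdot> \<sigma>") auto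
  then show ?case using root by fastforce
next
  case (arg ts i u f)
  then obtain l r \<sigma> p where "(l, r) \<in> R" "is_subst ar \<sigma>" "p \<in> poss (ts ! i)"
     "subt_at (ts ! i) p = l \<cdot> \<sigma>" "u = replace_at (ts ! i) p (r \<cdot> \<sigma>)" by blast
  then show ?case using arg(2)
    by (intro exI[of _ l] exI[of _ r] exI[of _ \<sigma>] exI[of _ "Suc i # p"]) auto
qed

lemma rew_rstep: "rew ar R s t \<Longrightarrow> is_trs ar R \<Longrightarrow> wf_trm ar s \<Longrightarrow> (s, t) \<in> rstep ar R"
  using rew_position[of ar R s t] rew_wf[of ar R s t] unfolding rstep_def by blast

lemma rews_rsteps: "(rew ar R)\<^sup>*\<^sup>* s t \<Longrightarrow> is_trs ar R \<Longrightarrow> wf_trm ar s \<Longrightarrow> (s, t) \<in> (rstep ar R)\<^sup>*"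
proof (induction rule: rtranclp_induct)
  case (step y z)
  then have "(y, z) \<in> rstep ar R" using rews_wf rew_rstep by metis
  then show ?case using step by (meson rtrancl.rtrancl_into_rtrancl)
qed simp

subsection \<open>Replacement at parallel positions\<close>

lemma replace_many_Nil [simp]: "replace_many t [] = t"
  by (simp add: replace_many_def)

lemma replace_many_Cons [simp]: "replace_many t ((p, s) # qs) = replace_many (replace_at t p s) qs"
  by (simp add: replace_many_def)

lemma Nil_in_poss [simp]: "[] \<in> poss t"
  by (cases t) auto

lemma subt_at_subst: "p \<in> poss t \<Longrightarrow> subt_at (t \<cdot> \<theta>) p = subt_at t p \<cdot> \<theta>"
  by (induction t arbitrary: p) auto

lemma replace_at_subst: "p \<in> poss t \<Longrightarrow> replace_at t p s \<cdot> \<theta> = replace_at (t \<cdot> \<theta>) p (s \<cdot> \<theta>)"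
  by (induction t arbitrary: p) (auto simp: map_update)

lemma vars_subt_at: "p \<in> poss t \<Longrightarrow> vars (subt_at t p) \<subseteq> vars t"
proof (induction t arbitrary: p)
  case (Fun f ts)
  show ?case
  proof (cases p)
    case (Cons i q)
    then obtain j where "i = Suc j" "j < length ts" "q \<in> poss (ts ! j)" using Fun.prems by auto
    moreover from this have "vars (subt_at (ts ! j) q) \<subseteq> vars (ts ! j)" using Fun.IH by simp
    ultimately show ?thesis using Cons by fastforce
  qed simp
qed simp

lemma wf_subt_at: "p \<in> poss t \<Longrightarrow> wf_trm ar t \<Longrightarrow> wf_trm ar (subt_at t p)"
  by (induction t arbitrary: p) auto

lemma poss_replace_at:
  "p \<in> poss t \<Longrightarrow> q \<in> poss t \<Longrightarrow> parallel p q \<Longrightarrow> q \<in> poss (replace_at t p s)"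
proof (induction t arbitrary: p q)
  case (Fun f ts)
  then obtain i p' j q' where "p = Suc i # p'" "i < length ts" "p' \<in> poss (ts ! i)"
    "q = Suc j # q'" "j < length ts" "q' \<in> poss (ts ! j)" by auto
  then show ?case using Fun by (auto simp: nth_list_update parallel_def)
qed auto

lemma replace_many_subst:
  assumes "sorted_wrt parallel (map fst qs)" "\<forall>p \<in> fst ` set qs. p \<in> poss t"
  shows "replace_many t qs \<cdot> \<theta> = replace_many (t \<cdot> \<theta>) (map (\<lambda>(p, s). (p, s \<cdot> \<theta>)) qs)"
  using assms
proof (induction qs arbitrary: t)
  case (Cons a qs)
  obtain p s where a: "a = (p, s)" by force
  have "\<forall>q \<in> fst ` set qs. q \<in> poss (replace_at t p s)"
    using Cons.prems a by (auto intro!: poss_replace_at)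
  then show ?case using Cons a by (simp add: replace_at_subst)
qed simp

text \<open>Positions count arguments from 1, hence \<open>Suc i\<close> for the argument of index
  \<open>i\<close>. The root position has to be excluded beforehand, since \<open>hd []\<close> is
  unspecified.\<close>

definition args_at :: "nat \<Rightarrow> (pos \<times> 'b) list \<Rightarrow> (pos \<times> 'b) list" where
  "args_at i qs = map (apfst tl) (filter (\<lambda>q. hd (fst q) = Suc i) qs)"

lemma replace_many_Fun:
  assumes "\<forall>p \<in> fst ` set qs. \<exists>i q. p = Suc i # q \<and> i < length ts"
  shows "replace_many (Fun f ts) qs =
    Fun f (map (\<lambda>i. replace_many (ts ! i) (args_at i qs)) [0..<length ts])"
  using assms
proof (induction qs arbitrary: ts)
  case Nil
  then show ?case by (simp add: args_at_def map_nth)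
next
  case (Cons a qs)
  obtain p s where a: "a = (p, s)" by force
  with Cons.prems obtain i q where p: "p = Suc i # q" "i < length ts" by auto
  have "replace_many (Fun f ts) (a # qs) = replace_many (Fun f (ts[i := replace_at (ts ! i) q s])) qs"
    by (simp add: a p)
  also have "\<dots> = Fun f (map (\<lambda>j. replace_many (ts[i := replace_at (ts ! i) q s] ! j) (args_at j qs))
      [0..<length ts])"
    using Cons.IH[of "ts[i := replace_at (ts ! i) q s]"] Cons.prems by simp
  also have "\<dots> = Fun f (map (\<lambda>j. replace_many (ts ! j) (args_at j (a # qs))) [0..<length ts])"
    using p by (auto simp: args_at_def a nth_list_update)
  finally show ?case .
qed

lemma args_at_map: "args_at i (map (apsnd g) qs) = map (apsnd g) (args_at i qs)"
  by (induction qs) (auto simp: args_at_def)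

lemma sorted_parallel_Nil: "sorted_wrt parallel ps \<Longrightarrow> [] \<in> set ps \<Longrightarrow> ps = [[]]"
  by (cases ps) (auto simp: parallel_def)

lemma parallel_Cons [simp]: "parallel (i # p) (j # q) \<longleftrightarrow> i \<noteq> j \<or> parallel p q"
  by (auto simp: parallel_def)

lemma sorted_args_at:
  assumes "sorted_wrt parallel (map fst qs)" "[] \<notin> fst ` set qs"
  shows "sorted_wrt parallel (map fst (args_at i qs))"
  using assms
proof (induction qs)
  case (Cons a qs)
  have "parallel (tl (fst a)) (tl (fst b))"
    if "b \<in> set qs" "hd (fst a) = Suc i" "hd (fst b) = Suc i" for b
  proof -
    have "parallel (hd (fst a) # tl (fst a)) (hd (fst b) # tl (fst b))"
      using Cons.prems that(1) by (metis (no_types, lifting) hd_Cons_tl image_eqI imageI list.set_intros(1,2)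
          list.simps(9) list.set_map sorted_wrt.simps(2))
    then show ?thesis using that by simp
  qed
  then show ?case using Cons by (auto simp: args_at_def)
qed (simp add: args_at_def)

text \<open>A redex at the root is the only one, by parallelism; otherwise the list splits into one
  list per argument. The condition speaks of the result \<open>t\<close>, whose subterms at the
  redex positions are the contracta.\<close>

lemma par_of_positions:
  assumes "sorted_wrt parallel (map fst qs)"
    and "\<forall>(p, (l, r), \<theta>) \<in> set qs. p \<in> poss s \<and> (l, r) \<in> R \<and> is_subst ar \<theta> \<and> subt_at s p = l \<cdot> \<theta>"
    and "t = replace_many s (map (apsnd (\<lambda>((l, r), \<theta>). r \<cdot> \<theta>)) qs)"
    and "vars_at (fst ` set qs) t \<subseteq> X"
  shows "par ar R X s t"
  using assms
proof (induction s arbitrary: qs t)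
  case (Var x)
  show ?case
  proof (cases qs)
    case Nil
    then show ?thesis using Var by (simp add: par.var)
  next
    case (Cons a qs')
    then have "[] \<in> set (map fst qs)" using Var(2) by auto
    then have "map fst qs = [[]]" using Var(1) sorted_parallel_Nil by blast
    then obtain l r \<theta> where "qs = [([], (l, r), \<theta>)]"
      by (metis (no_types, opaque_lifting) map_eq_Cons_conv Nil_is_map_conv prod.collapse)
    then show ?thesis using Var par.root[of l r R ar \<theta> X] by (auto simp: vars_at_def)
  qed
next
  case (Fun f ts)
  let ?g = "\<lambda>((l, r), \<theta>). r \<cdot> \<theta>"
  show ?case
  proof (cases "[] \<in> set (map fst qs)")
    case True
    then have "map fst qs = [[]]" using Fun.prems(1) sorted_parallel_Nil by blast
    then obtain l r \<theta> where "qs = [([], (l, r), \<theta>)]"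
      by (metis (no_types, opaque_lifting) map_eq_Cons_conv Nil_is_map_conv prod.collapse)
    then show ?thesis using Fun.prems par.root[of l r R ar \<theta> X] by (auto simp: vars_at_def)
  next
    case False
    have pos: "\<exists>i q. p = Suc i # q \<and> i < length ts \<and> q \<in> poss (ts ! i) \<and> (fst x) \<in> R \<and>
        is_subst ar (snd x) \<and> subt_at (ts ! i) q = fst (fst x) \<cdot> snd x" if "(p, x) \<in> set qs" for p x
    proof -
      obtain l r \<theta> where x: "x = ((l, r), \<theta>)" by (metis prod.collapse)
      have "p \<noteq> []" using False that by force
      moreover have "p \<in> poss (Fun f ts) \<and> (l, r) \<in> R \<and> is_subst ar \<theta> \<and> subt_at (Fun f ts) p = l \<cdot> \<theta>"
        using Fun.prems(2) that x by auto
      ultimately show ?thesis using x by auto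
    qed
    define us where "us = map (\<lambda>i. replace_many (ts ! i) (args_at i (map (apsnd ?g) qs))) [0..<length ts]"
    have t: "t = Fun f us"
      unfolding Fun.prems(3) us_def
      by (rule replace_many_Fun) (use pos in fastforce)
    have "par ar R X (ts ! i) (us ! i)" if i: "i < length ts" for i
    proof (rule Fun.IH)
      show "ts ! i \<in> set ts" using i by simp
      show "sorted_wrt parallel (map fst (args_at i qs))"
        using Fun.prems(1) False by (intro sorted_args_at) auto
      show "\<forall>(p, (l, r), \<theta>) \<in> set (args_at i qs).
          p \<in> poss (ts ! i) \<and> (l, r) \<in> R \<and> is_subst ar \<theta> \<and> subt_at (ts ! i) p = l \<cdot> \<theta>"
        using pos by (fastforce simp: args_at_def)
      show "us ! i = replace_many (ts ! i) (map (apsnd ?g) (args_at i qs))"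
        using i by (simp add: us_def args_at_map)
      show "vars_at (fst ` set (args_at i qs)) (us ! i) \<subseteq> X"
      proof -
        have "vars (subt_at (us ! i) q) \<subseteq> X" if q: "q \<in> fst ` set (args_at i qs)" for q
        proof -
          have "Suc i # q \<in> fst ` set qs" using q pos by (force simp: args_at_def)
          then have "vars (subt_at t (Suc i # q)) \<subseteq> X"
            using Fun.prems(4) unfolding vars_at_def by blast
          then show ?thesis by (simp add: t)
        qed
        then show ?thesis by (auto simp: vars_at_def)
      qed
    qed
    then show ?thesis unfolding t by (intro par.args) (auto simp: us_def)
  qed
qed

lemma par_rstep_at_par:
  assumes "(s, t) \<in> par_rstep_at ar R V" "vars_at V t \<subseteq> X"
  shows "par ar R X s t"
proof -
  from assms(1) obtain qs :: "(pos \<times> ('a, 'b) rule \<times> ('a, 'b) subst) list" where qs: "V = set (map fst qs)"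
    "sorted_wrt parallel (map fst qs)"
    "\<forall>(p, (l, r), \<theta>) \<in> set qs. p \<in> poss s \<and> (l, r) \<in> R \<and> is_subst ar \<theta> \<and> subt_at s p = l \<cdot> \<theta>"
    "t = replace_many s (map (\<lambda>(p, (l, r), \<theta>). (p, r \<cdot> \<theta>)) qs)"
    unfolding par_rstep_at_def by blast
  have "map (\<lambda>(p, (l, r), \<theta>). (p, r \<cdot> \<theta>)) qs = map (apsnd (\<lambda>((l, r), \<theta>). r \<cdot> \<theta>)) qs"
    by auto
  from qs(4)[unfolded this] show ?thesis
    by (rule par_of_positions[OF qs(2,3)]) (use qs(1) assms(2) in simp)
qed

lemma par_rstep_par: "(s, t) \<in> par_rstep ar R \<Longrightarrow> par ar R UNIV s t"
  unfolding par_rstep_def using par_rstep_at_par by blast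

subsection \<open>Renaming rules apart\<close>

lemma variant_refl: "variant \<rho> \<rho>"
  unfolding variant_def by (rule exI[of _ id]) simp

lemma variants_of_self: "\<rho> \<in> R \<Longrightarrow> \<rho> \<in> variants_of R"
  unfolding variants_of_def using variant_refl by blast

lemma finite_rule_vars [simp]: "finite (rule_vars \<rho>)"
  by (simp add: rule_vars_def)

lemma variant_vars:
  assumes "variant \<rho> \<rho>'" "vars (snd \<rho>') \<subseteq> vars (fst \<rho>')"
  shows "vars (snd \<rho>) \<subseteq> vars (fst \<rho>)"
  using assms by (fastforce simp: variant_def vars_subst)

lemma variant_wf: "variant \<rho> \<rho>' \<Longrightarrow> wf_trm ar (fst \<rho>') \<Longrightarrow> wf_trm ar (fst \<rho>)"
  by (auto simp: variant_def intro!: wf_subst)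

text \<open>\<open>B\<close> is swapped with an equally large set \<open>C\<close> outside
  \<open>A \<union> B\<close>. A swap, unlike a mere injection of \<open>B\<close>, is a bijection
  on all variables, as \<open>variant\<close> demands.\<close>

lemma fresh_involution:
  fixes A B :: "'v set"
  assumes "infinite (UNIV :: 'v set)" "finite A" "finite B"
  shows "\<exists>\<pi> :: 'v \<Rightarrow> 'v. (\<forall>x. \<pi> (\<pi> x) = x) \<and> \<pi> ` B \<inter> A = {}"
proof -
  obtain C where C: "C \<subseteq> UNIV - (A \<union> B)" "finite C" "card C = card B"
    using infinite_arbitrarily_large[of "UNIV - (A \<union> B)" "card B"] assms by auto
  then obtain f where f: "bij_betw f B C" using assms(3) by (metis finite_same_card_bij)
  define \<pi> where "\<pi> x = (if x \<in> B then f x else if x \<in> C then inv_into B f x else x)" for x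
  have BC: "B \<inter> C = {}" using C by auto
  have "\<pi> (\<pi> x) = x" for x
  proof -
    consider "x \<in> B" | "x \<in> C" "x \<notin> B" | "x \<notin> B" "x \<notin> C" by blast
    then show ?thesis
    proof cases
      case 1
      then have "f x \<in> C" "f x \<notin> B" using f BC bij_betwE by blast+
      then show ?thesis using 1 f by (simp add: \<pi>_def bij_betw_inv_into_left)
    next
      case 2
      then have "inv_into B f x \<in> B" using f by (metis bij_betw_def inv_into_into)
      then show ?thesis using 2 f by (simp add: \<pi>_def bij_betw_inv_into_right)
    qed (simp add: \<pi>_def)
  qed
  moreover have "\<pi> ` B \<subseteq> C" using f by (auto simp: \<pi>_def bij_betw_def)
  ultimately show ?thesis using C(1) by (intro exI[of _ \<pi>]) auto
qed

text \<open>The rules are renamed one after the other, and the variables of each renamed rule join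
  \<open>A\<close>, so that later ones avoid them. Disjointness then lets the separate substitutions
  be glued into a single \<open>\<tau>\<close>.\<close>

lemma rename_rules:
  fixes rs :: "(('f, 'v) rule \<times> ('f, 'v) subst) list"
  assumes "infinite (UNIV :: 'v set)" "finite A" "is_subst ar \<tau>0"
    and "\<forall>(\<rho>, \<theta>) \<in> set rs. is_subst ar \<theta>"
  shows "\<exists>rs' \<tau>. is_subst ar \<tau> \<and> (\<forall>x \<in> A. \<tau> x = \<tau>0 x) \<and>
    list_all2 (\<lambda>\<rho>' (\<rho>, \<theta>). variant \<rho>' \<rho> \<and> fst \<rho>' \<cdot> \<tau> = fst \<rho> \<cdot> \<theta> \<and> snd \<rho>' \<cdot> \<tau> = snd \<rho> \<cdot> \<theta>) rs' rs \<and>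
    sorted_wrt (\<lambda>\<rho> \<rho>'. rule_vars \<rho> \<inter> rule_vars \<rho>' = {}) rs' \<and> (\<forall>\<rho> \<in> set rs'. A \<inter> rule_vars \<rho> = {})"
  using assms(2-)
proof (induction rs arbitrary: A \<tau>0)
  case Nil
  then show ?case by (intro exI[of _ "[]"] exI[of _ \<tau>0]) simp
next
  case (Cons a rs)
  obtain \<rho> \<theta> where a: "a = (\<rho>, \<theta>)" by (cases a)
  then have \<theta>: "is_subst ar \<theta>" using Cons.prems by auto
  obtain \<pi> where \<pi>: "\<And>x. \<pi> (\<pi> x) = x" "\<pi> ` rule_vars \<rho> \<inter> A = {}"
    using fresh_involution[OF assms(1) Cons.prems(1) finite_rule_vars] by blast
  let ?R = "\<lambda>x. Var (\<pi> x)"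
  define \<rho>' where "\<rho>' = (fst \<rho> \<cdot> ?R, snd \<rho> \<cdot> ?R)"
  have rv: "rule_vars \<rho>' = \<pi> ` rule_vars \<rho>"
    by (auto simp: \<rho>'_def rule_vars_def vars_subst)
  have "bij \<pi>" using \<pi>(1) by (metis involuntory_imp_bij)
  then have var: "variant \<rho>' \<rho>" unfolding variant_def \<rho>'_def by auto
  define \<tau>1 where "\<tau>1 x = (if x \<in> rule_vars \<rho>' then \<theta> (\<pi> x) else \<tau>0 x)" for x
  have \<tau>1: "is_subst ar \<tau>1"
    by (rule is_subst_finite_change[OF Cons.prems(2), of "rule_vars \<rho>'"])
      (use \<theta> in \<open>auto simp: \<tau>1_def is_subst_def\<close>)
  have \<tau>1_\<rho>: "\<tau>1 (\<pi> x) = \<theta> x" if "x \<in> rule_vars \<rho>" for x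
    using that \<pi>(1) by (simp add: \<tau>1_def rv)
  obtain rs' \<tau> where IH: "is_subst ar \<tau>" "\<forall>x \<in> A \<union> rule_vars \<rho>'. \<tau> x = \<tau>1 x"
    "list_all2 (\<lambda>\<rho>' (\<rho>, \<theta>). variant \<rho>' \<rho> \<and> fst \<rho>' \<cdot> \<tau> = fst \<rho> \<cdot> \<theta> \<and> snd \<rho>' \<cdot> \<tau> = snd \<rho> \<cdot> \<theta>) rs' rs"
    "sorted_wrt (\<lambda>\<rho> \<rho>'. rule_vars \<rho> \<inter> rule_vars \<rho>' = {}) rs'"
    "\<forall>\<rho> \<in> set rs'. (A \<union> rule_vars \<rho>') \<inter> rule_vars \<rho> = {}"
    using Cons.IH[of "A \<union> rule_vars \<rho>'" \<tau>1] Cons.prems \<tau>1 by auto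
  have "\<tau> x = \<tau>0 x" if "x \<in> A" for x
    using IH(2) that \<pi>(2) rv by (auto simp: \<tau>1_def)
  moreover have "\<tau> (\<pi> x) = \<theta> x" if "x \<in> rule_vars \<rho>" for x
    using IH(2) \<tau>1_\<rho>[OF that] rv that by auto
  then have "fst \<rho>' \<cdot> \<tau> = fst \<rho> \<cdot> \<theta>" "snd \<rho>' \<cdot> \<tau> = snd \<rho> \<cdot> \<theta>"
    by (auto simp: \<rho>'_def rule_vars_def intro: subst_cong)
  moreover have "\<forall>\<rho> \<in> set rs'. A \<inter> rule_vars \<rho> = {} \<and> rule_vars \<rho>' \<inter> rule_vars \<rho> = {}"
    using IH(5) by blast
  moreover have "A \<inter> rule_vars \<rho>' = {}" using \<pi>(2) rv by blast
  ultimately show ?case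
    using IH(1,3,4) var a by (intro exI[of _ "\<rho>' # rs'"] exI[of _ \<tau>]) simp
qed

definition overlap_eqs ::
  "('f, 'v) trm \<Rightarrow> (pos \<times> ('f, 'v) rule) list \<Rightarrow> (('f, 'v) trm \<times> ('f, 'v) trm) set" where
  "overlap_eqs t os = {(l, subt_at t p) | p l r. (p, (l, r)) \<in> set os}"

text \<open>Common preparation for ordinary and parallel critical pairs: redexes inside
  \<open>l' \<cdot> \<theta>\<close>, each with a substitution of its own, become one unifier
  \<open>\<tau>\<close> of variable-disjoint variants, and \<open>\<tau>\<close> factors through the
  mgu with itself as second factor.\<close>

lemma overlap_mgu:
  fixes os :: "(pos \<times> ('f, 'v) rule \<times> ('f, 'v) subst) list"
  assumes inf: "infinite (UNIV :: 'v set)" and R: "is_trs ar R"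
    and wf: "wf_trm ar l'" and \<theta>: "is_subst ar \<theta>"
    and os: "\<forall>(p, (l, r), \<theta>i) \<in> set os. p \<in> poss l' \<and> (l, r) \<in> R \<and> is_subst ar \<theta>i \<and>
      subt_at l' p \<cdot> \<theta> = l \<cdot> \<theta>i"
  shows "\<exists>os' \<sigma> \<tau>. map fst os' = map fst os \<and> set (map snd os') \<subseteq> variants_of R \<and>
    sorted_wrt (\<lambda>\<rho> \<rho>'. rule_vars \<rho> \<inter> rule_vars \<rho>' = {}) ((l', r') # map snd os') \<and>
    strong_mgu ar \<sigma> (overlap_eqs l' os') \<and> is_mgu ar \<sigma> (overlap_eqs l' os') \<and>
    is_subst ar \<tau> \<and> (\<forall>x \<in> rule_vars (l', r'). \<tau> x = \<theta> x) \<and> (\<forall>x. \<tau> x = \<sigma> x \<cdot> \<tau>) \<and>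
    map (\<lambda>(p, (l, r)). (p, r \<cdot> \<tau>)) os' = map (apsnd (\<lambda>((l, r), \<theta>). r \<cdot> \<theta>)) os \<and>
    (\<forall>(p, (l, r)) \<in> set os'. vars r \<subseteq> vars l)"
proof -
  have "\<forall>(\<rho>, \<theta>) \<in> set (map snd os). is_subst ar \<theta>" using os by fastforce
  from rename_rules[OF inf finite_rule_vars[of "(l', r')"] \<theta> this]
  obtain rs' \<tau> where \<tau>: "is_subst ar \<tau>" "\<forall>x \<in> rule_vars (l', r'). \<tau> x = \<theta> x"
    and rs: "list_all2 (\<lambda>\<rho>' (\<rho>, \<theta>). variant \<rho>' \<rho> \<and> fst \<rho>' \<cdot> \<tau> = fst \<rho> \<cdot> \<theta> \<and> snd \<rho>' \<cdot> \<tau> = snd \<rho> \<cdot> \<theta>)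
      rs' (map snd os)"
    and disj: "sorted_wrt (\<lambda>\<rho> \<rho>'. rule_vars \<rho> \<inter> rule_vars \<rho>' = {}) rs'"
      "\<forall>\<rho> \<in> set rs'. rule_vars (l', r') \<inter> rule_vars \<rho> = {}" by blast
  have len: "length rs' = length os" using rs by (auto dest: list_all2_lengthD)
  define os' where "os' = zip (map fst os) rs'"
  have fst_os': "map fst os' = map fst os" and snd_os': "map snd os' = rs'"
    using len by (auto simp: os'_def)
  have nth: "\<exists>l r \<theta>i. os ! i = (fst (os' ! i), (l, r), \<theta>i) \<and> variant (snd (os' ! i)) (l, r) \<and>
      fst (snd (os' ! i)) \<cdot> \<tau> = l \<cdot> \<theta>i \<and> snd (snd (os' ! i)) \<cdot> \<tau> = r \<cdot> \<theta>i"
    if i: "i < length os" for i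
  proof -
    obtain p l r \<theta>i where o: "os ! i = (p, (l, r), \<theta>i)" by (metis prod.collapse)
    moreover have "os' ! i = (p, rs' ! i)" using i len o by (simp add: os'_def)
    moreover have "variant (rs' ! i) (l, r) \<and> fst (rs' ! i) \<cdot> \<tau> = l \<cdot> \<theta>i \<and> snd (rs' ! i) \<cdot> \<tau> = r \<cdot> \<theta>i"
      using list_all2_nthD[OF rs, of i] i len o by simp
    ultimately show ?thesis by simp
  qed
  have len': "length os' = length os" using fst_os' by (metis length_map)
  have mem: "p \<in> poss l' \<and> (\<exists>\<rho> \<in> R. variant (l, r) \<rho>) \<and> wf_trm ar l \<and> vars r \<subseteq> vars l \<and>
      l \<cdot> \<tau> = subt_at l' p \<cdot> \<tau>" if in_os': "(p, (l, r)) \<in> set os'" for p l r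
  proof -
    obtain i where i: "i < length os" "os' ! i = (p, (l, r))"
      using in_os' len' by (metis in_set_conv_nth)
    obtain l0 r0 \<theta>i where *: "os ! i = (p, (l0, r0), \<theta>i)" "variant (l, r) (l0, r0)"
      "l \<cdot> \<tau> = l0 \<cdot> \<theta>i" using nth[OF i(1)] i(2) by auto
    have **: "p \<in> poss l'" "(l0, r0) \<in> R" "subt_at l' p \<cdot> \<theta> = l0 \<cdot> \<theta>i"
      using os nth_mem[OF i(1)] *(1) by auto
    have "subt_at l' p \<cdot> \<tau> = subt_at l' p \<cdot> \<theta>"
      by (rule subst_cong) (use \<tau>(2) vars_subt_at[OF **(1)] in \<open>auto simp: rule_vars_def\<close>)
    moreover have "wf_trm ar l" using variant_wf[OF *(2)] is_trsD(1)[OF R **(2)] by simp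
    moreover have "vars r \<subseteq> vars l" using variant_vars[OF *(2)] is_trsD(4)[OF R **(2)] by simp
    ultimately show ?thesis using * ** by auto
  qed
  let ?E = "map (\<lambda>(p, (l, r)). (l, subt_at l' p)) os'"
  have E: "set ?E = overlap_eqs l' os'" by (force simp: overlap_eqs_def)
  have "unifies \<tau> (set ?E)" using mem by (auto simp: unifies_def)
  moreover have "\<forall>(s, t) \<in> set ?E. wf_trm ar s \<and> wf_trm ar t"
    using mem wf by (fastforce intro: wf_subt_at)
  ultimately obtain \<sigma> where "strong_mgu ar \<sigma> (set ?E)" by (metis strong_mgu_exists)
  moreover from this have "\<forall>x. \<tau> x = \<sigma> x \<cdot> \<tau>"
    using \<open>unifies \<tau> (set ?E)\<close> unfolding strong_mgu_def by blast
  moreover from calculation(1) have "is_mgu ar \<sigma> (set ?E)" by (rule strong_mgu_is_mgu) simp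
  moreover have "map (\<lambda>(p, (l, r)). (p, r \<cdot> \<tau>)) os' = map (apsnd (\<lambda>((l, r), \<theta>). r \<cdot> \<theta>)) os"
  proof (rule nth_equalityI)
    fix i assume "i < length (map (\<lambda>(p, (l, r)). (p, r \<cdot> \<tau>)) os')"
    then show "map (\<lambda>(p, (l, r)). (p, r \<cdot> \<tau>)) os' ! i = map (apsnd (\<lambda>((l, r), \<theta>). r \<cdot> \<theta>)) os ! i"
      using nth[of i] len' by (auto simp: case_prod_unfold)
  qed (simp add: len')
  moreover have "set (map snd os') \<subseteq> variants_of R"
    using mem unfolding variants_of_def by auto
  moreover have "\<forall>(p, (l, r)) \<in> set os'. vars r \<subseteq> vars l" using mem by auto
  ultimately show ?thesis
    using fst_os' \<tau> disj unfolding E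
    by (intro exI[of _ os'] exI[of _ \<sigma>] exI[of _ \<tau>]) (simp add: snd_os')
qed

subsection \<open>Critical pairs\<close>

text \<open>The first alternative accounts for the root overlap of a rule with a variant of itself,
  which \<open>CP\<close> excludes; there both results coincide, because right-hand sides have no
  extra variables.\<close>

lemma CP_overlap:
  fixes R Q :: "('f, 'v) rule set"
  assumes inf: "infinite (UNIV :: 'v set)" and R: "is_trs ar R" and Q: "is_trs ar Q"
    and Q2: "(l2, r2) \<in> Q" and \<theta>: "is_subst ar \<theta>"
    and p: "p \<in> poss l2" "\<not> is_Var (subt_at l2 p)"
    and R1: "(l1, r1) \<in> R" "is_subst ar \<theta>1" "subt_at l2 p \<cdot> \<theta> = l1 \<cdot> \<theta>1"
  shows "replace_at (l2 \<cdot> \<theta>) p (r1 \<cdot> \<theta>1) = r2 \<cdot> \<theta> \<or>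
    (\<exists>u v \<tau>. (u, v) \<in> CP ar R Q \<and> is_subst ar \<tau> \<and>
      replace_at (l2 \<cdot> \<theta>) p (r1 \<cdot> \<theta>1) = u \<cdot> \<tau> \<and> r2 \<cdot> \<theta> = v \<cdot> \<tau>)"
proof -
  have os: "\<forall>(p, (l, r), \<theta>i) \<in> set [(p, (l1, r1), \<theta>1)]. p \<in> poss l2 \<and> (l, r) \<in> R \<and> is_subst ar \<theta>i \<and>
      subt_at l2 p \<cdot> \<theta> = l \<cdot> \<theta>i" using p R1 by simp
  obtain os' \<sigma> \<tau> where
    *: "map fst os' = map fst [(p, (l1, r1), \<theta>1)]" "set (map snd os') \<subseteq> variants_of R"
    "sorted_wrt (\<lambda>\<rho> \<rho>'. rule_vars \<rho> \<inter> rule_vars \<rho>' = {}) ((l2, r2) # map snd os')"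
    "is_mgu ar \<sigma> (overlap_eqs l2 os')"
    "is_subst ar \<tau>" "\<forall>x \<in> rule_vars (l2, r2). \<tau> x = \<theta> x" "\<forall>x. \<tau> x = \<sigma> x \<cdot> \<tau>"
    "map (\<lambda>(p, (l, r)). (p, r \<cdot> \<tau>)) os' = map (apsnd (\<lambda>((l, r), \<theta>). r \<cdot> \<theta>)) [(p, (l1, r1), \<theta>1)]"
    "strong_mgu ar \<sigma> (overlap_eqs l2 os')"
    using overlap_mgu[OF inf R is_trsD(1)[OF Q Q2] \<theta> os, of r2] by blast
  from *(1) obtain l r where os': "os' = [(p, (l, r))]"
    by (metis (no_types, opaque_lifting) map_eq_Cons_conv Nil_is_map_conv list.simps(8,9) prod.collapse fst_conv)
  have r: "r \<cdot> \<tau> = r1 \<cdot> \<theta>1" using *(8) os' by simp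
  have E: "overlap_eqs l2 os' = {(l, subt_at l2 p)}" by (auto simp: overlap_eqs_def os')
  have l2: "l2 \<cdot> \<theta> = l2 \<cdot> \<tau>" and r2: "r2 \<cdot> \<theta> = r2 \<cdot> \<tau>"
    using *(6) by (auto intro!: subst_cong simp: rule_vars_def)
  have \<sigma>\<tau>: "t \<cdot> \<tau> = t \<cdot> \<sigma> \<cdot> \<tau>" for t using *(7) by (auto intro: subst_cong)
  show ?thesis
  proof (cases "p = [] \<and> variant (l, r) (l2, r2)")
    case True
    then obtain \<pi> where \<pi>: "l = l2 \<cdot> (\<lambda>x. Var (\<pi> x))" "r = r2 \<cdot> (\<lambda>x. Var (\<pi> x))"
      by (auto simp: variant_def)
    have "l \<cdot> \<sigma> = l2 \<cdot> \<sigma>" using *(4) True unfolding E is_mgu_def unifies_def by simp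
    \<comment> \<open>Unifying \<open>l2\<close> with its own variant forces \<open>\<tau>\<close>
      and its composition with \<open>\<pi>\<close> to agree on the variables of \<open>l2\<close>,
      hence on those of \<open>r2\<close>.\<close>
    then have "l2 \<cdot> (\<lambda>x. \<tau> (\<pi> x)) = l2 \<cdot> \<tau>" using \<pi>(1) \<sigma>\<tau> by (metis (no_types, lifting) subst_apply.simps(1) subst_cong subst_subst)
    then have "r2 \<cdot> (\<lambda>x. \<tau> (\<pi> x)) = r2 \<cdot> \<tau>"
      using is_trsD(4)[OF Q Q2] by (intro subst_cong) (metis subsetD subst_eqD)
    then show ?thesis using \<pi>(2) r r2 True by simp
  next
    case False
    have "(replace_at l2 p r \<cdot> \<sigma>, r2 \<cdot> \<sigma>) \<in> CP ar R Q"
      unfolding CP_def mem_Collect_eq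
      using *(2,3)[unfolded os'] *(4)[unfolded E] p False variants_of_self[OF Q2]
      by (rule_tac exI[of _ l], rule_tac exI[of _ r], rule_tac exI[of _ l2], rule_tac exI[of _ r2],
          rule_tac exI[of _ p], rule_tac exI[of _ \<sigma>]) (simp add: Int_commute)
    moreover have "replace_at (l2 \<cdot> \<theta>) p (r1 \<cdot> \<theta>1) = replace_at l2 p r \<cdot> \<sigma> \<cdot> \<tau>"
      unfolding \<sigma>\<tau>[symmetric] unfolding replace_at_subst[OF p(1)] l2 r ..
    moreover have "r2 \<cdot> \<theta> = r2 \<cdot> \<sigma> \<cdot> \<tau>" using r2 \<sigma>\<tau> by metis
    ultimately show ?thesis using *(5) by blast
  qed
qed

lemma rews_update_subst:
  "rew ar R (\<theta> x) s \<Longrightarrow> (rew ar R)\<^sup>*\<^sup>* (t \<cdot> \<theta>) (t \<cdot> \<theta>(x := s))"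
  by (induction t) (auto intro!: rews_args)

text \<open>As \<open>t\<close> may be non-linear, a step inside \<open>\<theta> x\<close> changes
  only one copy of \<open>\<theta> x\<close>; the further steps from \<open>v\<close> bring the
  other copies along.\<close>

lemma rew_instance_cases:
  assumes "rew ar R (t \<cdot> \<theta>) v" "is_trs ar R"
  shows "(\<exists>p l r \<theta>1. p \<in> poss t \<and> \<not> is_Var (subt_at t p) \<and> (l, r) \<in> R \<and> is_subst ar \<theta>1 \<and>
      subt_at t p \<cdot> \<theta> = l \<cdot> \<theta>1 \<and> v = replace_at (t \<cdot> \<theta>) p (r \<cdot> \<theta>1)) \<or>
    (\<exists>x s. x \<in> vars t \<and> rew ar R (\<theta> x) s \<and> (rew ar R)\<^sup>*\<^sup>* v (t \<cdot> \<theta>(x := s)))"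
  using assms(1)
proof (induction t arbitrary: v)
  case (Var y)
  then show ?case by auto
next
  case (Fun f ts)
  from Fun.prems show ?case
  proof (cases rule: rew.cases)
    case (root l r \<sigma>)
    then show ?thesis by (intro disjI1 exI[of _ "[]"]) auto
  next
    case (arg ss i u g)
    then have i: "i < length ts" and v: "v = Fun f ((map (\<lambda>t. t \<cdot> \<theta>) ts)[i := u])"
      and u: "rew ar R (ts ! i \<cdot> \<theta>) u" by auto
    from Fun.IH[OF nth_mem[OF i] u] show ?thesis
    proof (elim disjE exE conjE)
      fix p l r \<theta>1 assume "p \<in> poss (ts ! i)" "\<not> is_Var (subt_at (ts ! i) p)" "(l, r) \<in> R"
        "is_subst ar \<theta>1" "subt_at (ts ! i) p \<cdot> \<theta> = l \<cdot> \<theta>1" "u = replace_at (ts ! i \<cdot> \<theta>) p (r \<cdot> \<theta>1)"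
      then show ?thesis using i v
        by (intro disjI1 exI[of _ "Suc i # p"] exI[of _ l] exI[of _ r] exI[of _ \<theta>1]) auto
    next
      fix x s assume x: "x \<in> vars (ts ! i)" "rew ar R (\<theta> x) s" "(rew ar R)\<^sup>*\<^sup>* u (ts ! i \<cdot> \<theta>(x := s))"
      have "(rew ar R)\<^sup>*\<^sup>* v (Fun f ts \<cdot> \<theta>(x := s))"
        unfolding v using x(3) i rews_update_subst[of ar R \<theta> x s, OF x(2)]
        by (auto intro!: rews_args simp: nth_list_update)
      moreover have "x \<in> vars (Fun f ts)" using x(1) i by auto
      ultimately show ?thesis using x(2) by blast
    qed
  qed
qed

text \<open>The first step is singled out because closing a peak from the side of the parallel step
  takes a genuine \<open>S\<close>-step.\<close>

lemma rew_update_subst: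
  assumes "rew ar R (\<theta> x) s" "x \<in> vars t"
  shows "\<exists>u. rew ar R (t \<cdot> \<theta>) u \<and> (rew ar R)\<^sup>*\<^sup>* u (t \<cdot> \<theta>(x := s))"
  using assms(2)
proof (induction t)
  case (Fun f ts)
  then obtain i where i: "i < length ts" "x \<in> vars (ts ! i)" by (auto simp: in_set_conv_nth)
  with Fun.IH obtain u where u: "rew ar R (ts ! i \<cdot> \<theta>) u" "(rew ar R)\<^sup>*\<^sup>* u (ts ! i \<cdot> \<theta>(x := s))"
    by (meson nth_mem)
  let ?ss = "map (\<lambda>t. t \<cdot> \<theta>) ts"
  have "rew ar R (Fun f ?ss) (Fun f (?ss[i := u]))"
    using u(1) i by (intro rew.arg) auto
  moreover have "(rew ar R)\<^sup>*\<^sup>* (Fun f (?ss[i := u])) (Fun f ts \<cdot> \<theta>(x := s))"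
    using u(2) i rews_update_subst[of ar R \<theta> x s, OF assms(1)]
    by (auto intro!: rews_args simp: nth_list_update)
  ultimately show ?case unfolding subst_apply.simps by blast
qed (use assms(1) in auto)

subsection \<open>Parallel steps on instances of linear terms\<close>

lemma vars_poss: "x \<in> vars t \<Longrightarrow> \<exists>p \<in> poss t. subt_at t p = Var x"
proof (induction t)
  case (Fun f ts)
  then obtain i where i: "i < length ts" "x \<in> vars (ts ! i)" by (auto simp: in_set_conv_nth)
  with Fun.IH obtain p where "p \<in> poss (ts ! i)" "subt_at (ts ! i) p = Var x" by (meson nth_mem)
  then show ?case using i by (intro bexI[of _ "Suc i # p"]) auto
qed auto

lemma linear_Fun_arg: "linear_trm (Fun f ts) \<Longrightarrow> i < length ts \<Longrightarrow> linear_trm (ts ! i)"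
  unfolding linear_trm_def
proof (intro ballI allI impI)
  fix p q x
  assume lin: "\<forall>p \<in> poss (Fun f ts). \<forall>q \<in> poss (Fun f ts). \<forall>x.
      subt_at (Fun f ts) p = Var x \<and> subt_at (Fun f ts) q = Var x \<longrightarrow> p = q"
    and i: "i < length ts" and *: "p \<in> poss (ts ! i)" "q \<in> poss (ts ! i)"
      "subt_at (ts ! i) p = Var x \<and> subt_at (ts ! i) q = Var x"
  have "Suc i # p \<in> poss (Fun f ts)" "Suc i # q \<in> poss (Fun f ts)" using i *(1,2) by auto
  with lin *(3) have "Suc i # p = Suc i # q" by (metis diff_Suc_1 subt_at.simps(2))
  then show "p = q" by simp
qed

lemma linear_Fun_disjoint:
  assumes "linear_trm (Fun f ts)" "i < length ts" "j < length ts" "x \<in> vars (ts ! i)" "x \<in> vars (ts ! j)"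
  shows "i = j"
proof -
  obtain p q where *: "p \<in> poss (ts ! i)" "subt_at (ts ! i) p = Var x"
    "q \<in> poss (ts ! j)" "subt_at (ts ! j) q = Var x" using vars_poss assms(4,5) by meson
  have "Suc i # p \<in> poss (Fun f ts)" "Suc j # q \<in> poss (Fun f ts)" using assms(2,3) * by auto
  with assms(1) * have "Suc i # p = Suc j # q"
    unfolding linear_trm_def by (metis diff_Suc_1 subt_at.simps(2))
  then show ?thesis by simp
qed

text \<open>Splits a parallel step from \<open>t \<cdot> \<theta>\<close>: the list \<open>os\<close> contains the redexes at
  non-variable positions of \<open>t\<close>, and \<open>\<theta>'\<close> arises from \<open>\<theta>\<close> by the remaining steps. By
  linearity, \<open>\<theta>'\<close> agrees with \<open>\<theta>\<close> inside the redexes.\<close>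

definition par_overlaps ::
  "('f \<Rightarrow> nat) \<Rightarrow> ('f, 'v) rule set \<Rightarrow> ('f, 'v) trm \<Rightarrow> ('f, 'v) subst \<Rightarrow>
   (pos \<times> ('f, 'v) rule \<times> ('f, 'v) subst) list \<Rightarrow> ('f, 'v) subst \<Rightarrow> ('f, 'v) trm \<Rightarrow> bool" where
  "par_overlaps ar R t \<theta> os \<theta>' u \<longleftrightarrow>
     sorted_wrt parallel (map fst os) \<and>
     (\<forall>(p, (l, r), \<theta>i) \<in> set os. p \<in> poss t \<and> \<not> is_Var (subt_at t p) \<and> (l, r) \<in> R \<and>
        is_subst ar \<theta>i \<and> subt_at t p \<cdot> \<theta> = l \<cdot> \<theta>i \<and> (\<forall>x \<in> vars (subt_at t p). \<theta>' x = \<theta> x)) \<and>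
     (\<forall>x. par ar R UNIV (\<theta> x) (\<theta>' x)) \<and> (\<forall>x. x \<notin> vars t \<longrightarrow> \<theta>' x = \<theta> x) \<and>
     u = replace_many (t \<cdot> \<theta>') (map (apsnd (\<lambda>((l, r), \<theta>). r \<cdot> \<theta>)) os)"

definition below :: "nat \<Rightarrow> (pos \<times> 'b) list \<Rightarrow> (pos \<times> 'b) list" where
  "below i qs = map (apfst ((#) (Suc i))) qs"

lemma args_at_append: "args_at i (xs @ ys) = args_at i xs @ args_at i ys"
  by (simp add: args_at_def)

lemma args_at_below: "args_at i (below j qs) = (if i = j then qs else [])"
  by (induction qs) (auto simp: args_at_def below_def)

lemma args_at_concat_below:
  "distinct js \<Longrightarrow> args_at i (concat (map (\<lambda>j. below j (os j)) js)) = (if i \<in> set js then os i else [])"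
  by (induction js) (auto simp: args_at_append args_at_below, simp add: args_at_def)

lemma sorted_concat_below:
  assumes "distinct js" "\<And>j. j \<in> set js \<Longrightarrow> sorted_wrt parallel (map fst (os j))"
  shows "sorted_wrt parallel (map fst (concat (map (\<lambda>j. below j (os j)) js)))"
  using assms
proof (induction js)
  case (Cons j js)
  have "sorted_wrt parallel (map fst (below j (os j)))"
    using Cons.prems(2)[of j] by (simp add: below_def sorted_wrt_map)
  then show ?case using Cons by (auto simp: sorted_wrt_append below_def)
qed simp

text \<open>Every redex lies inside an argument, so the overlaps avoid the root; this is what leads
  to inner parallel critical pairs only.\<close>

lemma par_overlaps_Fun:
  assumes lin: "linear_trm (Fun f ts)" and len: "length us = length ts"
    and args: "\<And>i. i < length ts \<Longrightarrow> \<exists>os \<theta>'. par_overlaps ar R (ts ! i) \<theta> os \<theta>' (us ! i)"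
  shows "\<exists>os \<theta>'. par_overlaps ar R (Fun f ts) \<theta> os \<theta>' (Fun f us) \<and> [] \<notin> fst ` set os"
proof -
  let ?g = "\<lambda>((l, r), \<theta>). r \<cdot> \<theta>"
  obtain os \<Theta> where arg: "\<And>i. i < length ts \<Longrightarrow> par_overlaps ar R (ts ! i) \<theta> (os i) (\<Theta> i) (us ! i)"
    using args by metis
  define qs where "qs = concat (map (\<lambda>i. below i (os i)) [0..<length ts])"
  \<comment> \<open>By linearity each variable of the term lies in exactly one argument, so the
    choice is unique and the local substitutions \<open>\<Theta> i\<close> fit together.\<close>
  define \<theta>' where "\<theta>' x = (if x \<in> vars (Fun f ts)
    then \<Theta> (SOME i. i < length ts \<and> x \<in> vars (ts ! i)) x else \<theta> x)" for x
  have \<theta>': "\<theta>' x = \<Theta> i x" if "i < length ts" "x \<in> vars (ts ! i)" for i x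
  proof -
    have "(SOME i. i < length ts \<and> x \<in> vars (ts ! i)) = i"
      using that linear_Fun_disjoint[OF lin] by (intro some_equality) auto
    moreover have "x \<in> vars (Fun f ts)" using that by auto
    ultimately show ?thesis by (simp add: \<theta>'_def)
  qed
  have q: "\<exists>i p. q = Suc i # p \<and> i < length ts \<and> (p, x) \<in> set (os i)" if "(q, x) \<in> set qs" for q x
    using that by (auto simp: qs_def below_def)
  have ov: "q \<in> poss (Fun f ts) \<and> \<not> is_Var (subt_at (Fun f ts) q) \<and>
      (l, r) \<in> R \<and> is_subst ar \<theta>i \<and> subt_at (Fun f ts) q \<cdot> \<theta> = l \<cdot> \<theta>i \<and>
      (\<forall>x \<in> vars (subt_at (Fun f ts) q). \<theta>' x = \<theta> x)" if z: "(q, (l, r), \<theta>i) \<in> set qs" for q l r \<theta>i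
  proof -
    from q[OF z] obtain i p where i: "q = Suc i # p" "i < length ts" "(p, (l, r), \<theta>i) \<in> set (os i)" by metis
    then have *: "p \<in> poss (ts ! i)" "\<not> is_Var (subt_at (ts ! i) p)" "(l, r) \<in> R" "is_subst ar \<theta>i"
      "subt_at (ts ! i) p \<cdot> \<theta> = l \<cdot> \<theta>i" "\<forall>x \<in> vars (subt_at (ts ! i) p). \<Theta> i x = \<theta> x"
      using arg[OF i(2)] by (auto simp: par_overlaps_def)
    moreover have "\<forall>x \<in> vars (subt_at (ts ! i) p). \<theta>' x = \<theta> x"
      using *(6) \<theta>'[OF i(2)] vars_subt_at[OF *(1)] by auto
    ultimately show ?thesis using i by auto
  qed
  have "Fun f us = replace_many (Fun f ts \<cdot> \<theta>') (map (apsnd ?g) qs)"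
  proof -
    have "us = map (\<lambda>i. replace_many (map (\<lambda>t. t \<cdot> \<theta>') ts ! i) (args_at i (map (apsnd ?g) qs)))
        [0..<length (map (\<lambda>t. t \<cdot> \<theta>') ts)]"
    proof (rule nth_equalityI)
      fix i assume "i < length us"
      then have i: "i < length ts" using len by simp
      have "ts ! i \<cdot> \<theta>' = ts ! i \<cdot> \<Theta> i" using \<theta>'[OF i] by (auto intro: subst_cong)
      moreover have "args_at i qs = os i"
        using i unfolding qs_def by (subst args_at_concat_below) auto
      ultimately show "us ! i = map (\<lambda>i. replace_many (map (\<lambda>t. t \<cdot> \<theta>') ts ! i)
          (args_at i (map (apsnd ?g) qs))) [0..<length (map (\<lambda>t. t \<cdot> \<theta>') ts)] ! i"
        using arg[OF i] i by (simp add: args_at_map par_overlaps_def)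
    qed (simp add: len)
    moreover have "replace_many (Fun f (map (\<lambda>t. t \<cdot> \<theta>') ts)) (map (apsnd ?g) qs) =
      Fun f (map (\<lambda>i. replace_many (map (\<lambda>t. t \<cdot> \<theta>') ts ! i) (args_at i (map (apsnd ?g) qs)))
        [0..<length (map (\<lambda>t. t \<cdot> \<theta>') ts)])"
      by (rule replace_many_Fun) (use q in fastforce)
    ultimately show ?thesis by simp
  qed
  moreover have "sorted_wrt parallel (map fst qs)"
    unfolding qs_def by (rule sorted_concat_below) (use arg in \<open>auto simp: par_overlaps_def\<close>)
  moreover have "\<forall>(p, (l, r), \<theta>i) \<in> set qs. p \<in> poss (Fun f ts) \<and> \<not> is_Var (subt_at (Fun f ts) p) \<and>
      (l, r) \<in> R \<and> is_subst ar \<theta>i \<and> subt_at (Fun f ts) p \<cdot> \<theta> = l \<cdot> \<theta>i \<and>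
      (\<forall>x \<in> vars (subt_at (Fun f ts) p). \<theta>' x = \<theta> x)"
    using ov by blast
  moreover have "par ar R UNIV (\<theta> x) (\<theta>' x)" for x
  proof (cases "x \<in> vars (Fun f ts)")
    case True
    then obtain i where i: "i < length ts" "x \<in> vars (ts ! i)" by (auto simp: in_set_conv_nth)
    then show ?thesis using \<theta>'[OF i] arg[OF i(1)] by (simp add: par_overlaps_def)
  next
    case False
    then show ?thesis by (simp only: \<theta>'_def if_False par_refl)
  qed
  moreover have "\<theta>' x = \<theta> x" if "x \<notin> vars (Fun f ts)" for x
    using that by (simp only: \<theta>'_def if_False)
  moreover have "[] \<notin> fst ` set qs" using q by force
  ultimately show ?thesis unfolding par_overlaps_def by blast
qed

lemma par_overlaps_exists:
  "par ar R UNIV (t \<cdot> \<theta>) u \<Longrightarrow> linear_trm t \<Longrightarrow> \<exists>os \<theta>'. par_overlaps ar R t \<theta> os \<theta>' u"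
proof (induction t arbitrary: u)
  case (Var x)
  \<comment> \<open>A step from an instance of a variable causes no overlap; its result simply
    becomes the new value of \<open>x\<close>.\<close>
  then show ?case
    by (intro exI[of _ "[]"] exI[of _ "\<theta>(x := u)"]) (auto simp: par_overlaps_def par_refl)
next
  case (Fun f ts)
  from Fun.prems(1) show ?case
  proof (cases rule: par.cases)
    case (root l r \<theta>1)
    then show ?thesis
      by (intro exI[of _ "[([], (l, r), \<theta>1)]"] exI[of _ \<theta>]) (auto simp: par_overlaps_def par_refl)
  next
    case (args us ss g)
    then have u: "u = Fun f us" and len: "length us = length ts"
      and *: "\<And>i. i < length ts \<Longrightarrow> par ar R UNIV (ts ! i \<cdot> \<theta>) (us ! i)" by auto
    have "\<exists>os \<theta>'. par_overlaps ar R (ts ! i) \<theta> os \<theta>' (us ! i)" if "i < length ts" for i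
      using Fun.IH[OF nth_mem[OF that] *[OF that] linear_Fun_arg[OF Fun.prems(2) that]] .
    from par_overlaps_Fun[OF Fun.prems(2) len this] show ?thesis unfolding u by blast
  qed (auto simp: par_refl)
qed

lemma par_overlaps_subst:
  assumes "par_overlaps ar R t \<theta> os \<theta>' u" "is_subst ar \<theta>" "is_trs ar R"
  shows "is_subst ar \<theta>'"
proof (rule is_subst_finite_change[OF assms(2), of "vars t"])
  fix x
  show "wf_trm ar (\<theta>' x)"
    using assms par_wf[of ar R UNIV "\<theta> x" "\<theta>' x"] by (auto simp: par_overlaps_def is_subst_def)
  show "\<theta>' x = \<theta> x" if "x \<notin> vars t"
    using assms(1) that by (auto simp: par_overlaps_def)
qed simp

subsection \<open>Parallel critical pairs\<close>

text \<open>The overlapping redexes form the critical pair, and the other steps pass into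
  \<open>\<tau>'\<close>. The result of the root step is an instance by \<open>\<tau>\<close>,
  before these steps, and \<open>u\<close> one by \<open>\<tau>'\<close>, after them. Agreement on
  \<open>X\<close> is what \<open>par_subst\<close> asks for.\<close>

lemma PCP_overlaps:
  fixes R :: "('f, 'v) rule set"
  assumes inf: "infinite (UNIV :: 'v set)" and R: "is_trs ar R" and Q: "is_trs ar Q"
    and Q2: "(l', r') \<in> Q" and \<theta>: "is_subst ar \<theta>"
    and ov: "par_overlaps ar R l' \<theta> os \<theta>' u" and os: "os \<noteq> []" "[] \<notin> fst ` set os"
  shows "\<exists>u0 v0 X \<tau> \<tau>'. (u0, v0, X) \<in> PCP_in ar R Q \<and> is_subst ar \<tau> \<and> is_subst ar \<tau>' \<and>
    (\<forall>x. par ar R UNIV (\<tau> x) (\<tau>' x)) \<and> (\<forall>x \<in> X. \<tau>' x = \<tau> x) \<and>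
    r' \<cdot> \<theta> = v0 \<cdot> \<tau> \<and> u = u0 \<cdot> \<tau>'"
proof -
  have \<theta>': "is_subst ar \<theta>'" by (rule par_overlaps_subst[OF ov \<theta> R])
  have "\<forall>(p, (l, r), \<theta>i) \<in> set os. p \<in> poss l' \<and> (l, r) \<in> R \<and> is_subst ar \<theta>i \<and>
      subt_at l' p \<cdot> \<theta> = l \<cdot> \<theta>i" using ov by (auto simp: par_overlaps_def)
  from overlap_mgu[OF inf R is_trsD(1)[OF Q Q2] \<theta> this, of r']
  obtain os' \<sigma> \<tau> where
    fst_os': "map fst os' = map fst os" and variants: "set (map snd os') \<subseteq> variants_of R"
    and disj: "sorted_wrt (\<lambda>\<rho> \<rho>'. rule_vars \<rho> \<inter> rule_vars \<rho>' = {}) ((l', r') # map snd os')"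
    and \<sigma>: "strong_mgu ar \<sigma> (overlap_eqs l' os')" "is_mgu ar \<sigma> (overlap_eqs l' os')"
    and \<tau>: "is_subst ar \<tau>" "\<And>x. x \<in> rule_vars (l', r') \<Longrightarrow> \<tau> x = \<theta> x"
    and \<sigma>\<tau>: "\<And>x. \<tau> x = \<sigma> x \<cdot> \<tau>"
    and rs: "map (\<lambda>(p, (l, r)). (p, r \<cdot> \<tau>)) os' = map (apsnd (\<lambda>((l, r), \<theta>). r \<cdot> \<theta>)) os"
    and rl: "\<And>p l r. (p, (l, r)) \<in> set os' \<Longrightarrow> vars r \<subseteq> vars l" by blast
  let ?P = "set (map fst os')" and ?E = "overlap_eqs l' os'"
  have P: "p \<in> poss l'" "\<not> is_Var (subt_at l' p)" "\<And>x. x \<in> vars (subt_at l' p) \<Longrightarrow> \<theta>' x = \<theta> x"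
    if "p \<in> ?P" for p
  proof -
    from that obtain l r \<theta>i where "(p, (l, r), \<theta>i) \<in> set os" unfolding fst_os' by auto
    then show "p \<in> poss l'" "\<not> is_Var (subt_at l' p)" "\<And>x. x \<in> vars (subt_at l' p) \<Longrightarrow> \<theta>' x = \<theta> x"
      using ov by (auto simp: par_overlaps_def)
  qed
  \<comment> \<open>\<open>\<tau>\<close> supplies the values for the renamed rules,
    \<open>\<theta>'\<close> the additional steps, which touch variables of \<open>l'\<close>
    only.\<close>
  define \<tau>' where "\<tau>' x = (if x \<in> vars l' then \<theta>' x else \<tau> x)" for x
  have \<tau>'_subst: "is_subst ar \<tau>'"
    by (rule is_subst_finite_change[OF \<tau>(1), of "vars l'"])
      (use \<theta>' in \<open>auto simp: \<tau>'_def is_subst_def\<close>)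
  have \<tau>\<tau>': "par ar R UNIV (\<tau> x) (\<tau>' x)" for x
    using ov \<tau>(2)[of x] by (auto simp: \<tau>'_def par_overlaps_def rule_vars_def par_refl)
  \<comment> \<open>Variables of the renamed left-hand sides do not occur in \<open>l'\<close>, and
    \<open>\<theta>'\<close> leaves those of the overlapped subterms of \<open>l'\<close>
    alone.\<close>
  have E: "\<tau>' x = \<tau> x" if x: "x \<in> eqs_vars ?E" for x
  proof (cases "x \<in> vars l'")
    case True
    from x obtain p l r where plr: "(p, (l, r)) \<in> set os'" "x \<in> vars l \<or> x \<in> vars (subt_at l' p)"
      by (auto simp: eqs_vars_def overlap_eqs_def)
    have "x \<notin> vars l" using plr(1) True disj by (fastforce simp: rule_vars_def)
    then have "\<theta>' x = \<theta> x" using plr P(3)[of p] by force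
    then show ?thesis using True \<tau>(2)[of x] by (simp add: \<tau>'_def rule_vars_def)
  qed (simp add: \<tau>'_def)
  have \<sigma>E: "\<And>x. x \<notin> eqs_vars ?E \<Longrightarrow> \<sigma> x = Var x"
    "\<And>x. x \<in> eqs_vars ?E \<Longrightarrow> vars (\<sigma> x) \<subseteq> eqs_vars ?E"
    using \<sigma>(1) by (auto simp: strong_mgu_def)
  \<comment> \<open>Off the equations \<open>\<sigma>\<close> is the identity; on them its values
    use only variables where \<open>\<tau>'\<close> and \<open>\<tau>\<close> agree, so the
    factorization of \<open>\<tau>\<close> carries over.\<close>
  have \<sigma>\<tau>': "\<sigma> x \<cdot> \<tau>' = \<tau>' x" for x
  proof (cases "x \<in> eqs_vars ?E")
    case True
    then have "\<sigma> x \<cdot> \<tau>' = \<sigma> x \<cdot> \<tau>" using E \<sigma>E(2) by (intro subst_cong) auto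
    then show ?thesis using \<sigma>\<tau>[of x] E[OF True] by simp
  qed (simp add: \<sigma>E(1))
  have X: "vars_at ?P (l' \<cdot> \<sigma>) \<subseteq> eqs_vars ?E"
  proof -
    have "vars (subt_at (l' \<cdot> \<sigma>) p) \<subseteq> eqs_vars ?E" if p: "p \<in> ?P" for p
    proof -
      have "vars (subt_at l' p) \<subseteq> eqs_vars ?E" using p by (fastforce simp: eqs_vars_def overlap_eqs_def)
      then show ?thesis using \<sigma>E(2) P(1)[OF p] by (fastforce simp: subt_at_subst vars_subst)
    qed
    then show ?thesis by (auto simp: vars_at_def)
  qed
  let ?u0 = "replace_many l' (map (\<lambda>(p, (l, r)). (p, r)) os') \<cdot> \<sigma>"
  have par: "sorted_wrt parallel (map fst os')" using ov fst_os' by (simp add: par_overlaps_def)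
  have "is_PCP ar R Q ?P ?u0 (r' \<cdot> \<sigma>) (vars_at ?P (l' \<cdot> \<sigma>))"
    unfolding is_PCP_def
  proof (rule exI[of _ os'], rule exI[of _ l'], rule exI[of _ r'], rule exI[of _ \<sigma>], intro conjI)
    show "os' \<noteq> []" using os(1) fst_os' by auto
    show "\<not> (\<exists>\<rho>. os' = [([], \<rho>)] \<and> variant \<rho> (l', r'))"
      using os(2) fst_os' by (metis list.set_intros(1) list.set_map list.simps(9) fst_conv)
  qed (use variants disj par P \<sigma>(2) variants_of_self[OF Q2] in \<open>auto simp: overlap_eqs_def\<close>)
  moreover have "[] \<notin> ?P" using os(2) fst_os' by simp
  ultimately have "(?u0, r' \<cdot> \<sigma>, vars_at ?P (l' \<cdot> \<sigma>)) \<in> PCP_in ar R Q"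
    unfolding PCP_in_def by blast
  moreover have "r' \<cdot> \<theta> = r' \<cdot> \<sigma> \<cdot> \<tau>"
    using \<sigma>\<tau> \<tau>(2) by (auto intro!: subst_cong simp: rule_vars_def)
  moreover have "u = ?u0 \<cdot> \<tau>'"
  proof -
    have "?u0 \<cdot> \<tau>' = replace_many l' (map (\<lambda>(p, (l, r)). (p, r)) os') \<cdot> \<tau>'"
      by (simp add: \<sigma>\<tau>')
    also have "\<dots> = replace_many (l' \<cdot> \<tau>') (map (\<lambda>(p, s). (p, s \<cdot> \<tau>')) (map (\<lambda>(p, (l, r)). (p, r)) os'))"
    proof (rule replace_many_subst)
      have fst: "map fst (map (\<lambda>(p, (l, r)). (p, r)) os') = map fst os'" by auto
      show "sorted_wrt parallel (map fst (map (\<lambda>(p, (l, r)). (p, r)) os'))"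
        unfolding fst by (rule par)
      show "\<forall>p \<in> fst ` set (map (\<lambda>(p, (l, r)). (p, r)) os'). p \<in> poss l'" using P(1) by force
    qed
    also have "map (\<lambda>(p, s). (p, s \<cdot> \<tau>')) (map (\<lambda>(p, (l, r)). (p, r)) os') =
        map (\<lambda>(p, (l, r)). (p, r \<cdot> \<tau>)) os'"
    proof -
      have "r \<cdot> \<tau>' = r \<cdot> \<tau>" if "(p, (l, r)) \<in> set os'" for p l r
      proof (rule subst_cong)
        fix x assume "x \<in> vars r"
        then have "x \<in> eqs_vars ?E"
          using rl[OF that] that by (fastforce simp: eqs_vars_def overlap_eqs_def)
        then show "\<tau>' x = \<tau> x" by (rule E)
      qed
      then show ?thesis by auto
    qed
    also have "\<dots> = map (apsnd (\<lambda>((l, r), \<theta>). r \<cdot> \<theta>)) os" by (rule rs)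
    also have "l' \<cdot> \<tau>' = l' \<cdot> \<theta>'" by (auto intro: subst_cong simp: \<tau>'_def)
    finally show ?thesis using ov by (simp add: par_overlaps_def)
  qed
  ultimately show ?thesis using \<tau>(1) \<tau>'_subst \<tau>\<tau>' X E by blast
qed

subsection \<open>Closing the peaks\<close>

lemma no_rew_Var:
  assumes "is_trs ar R" shows "\<not> rew ar R (Var x) t"
proof
  assume "rew ar R (Var x) t"
  then obtain l r \<sigma> where lr: "(l, r) \<in> R" "Var x = l \<cdot> \<sigma>" by cases auto
  then show False using is_trsD(3)[OF assms lr(1)] by (cases l) auto
qed

text \<open>\<open>Q\<close> stands for \<open>P \<union> P\<inverse>\<close>. What remains of
  reversibility here is that \<open>Q\<close> is a TRS and equal to its converse.\<close>

locale reversible_system =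
  fixes ar :: "'f \<Rightarrow> nat" and Q S P' :: "('f, 'v) rule set"
  assumes inf: "infinite (UNIV :: 'v set)"
    and Q: "is_trs ar Q" and S: "is_trs ar S" and P': "is_trs ar P'"
    and sym_Q: "Q\<inverse> = Q" and P'_Q: "P' \<subseteq> Q"
    and lin: "left_linear S"
    and CP_SS: "CP ar S S \<subseteq>
      (rstep ar (S \<union> P'))\<^sup>* O (par_rstep ar Q)\<inverse> O ((rstep ar (S \<union> P'))\<^sup>*)\<inverse>"
    and PCP_QS: "\<forall>(u, v, X) \<in> PCP_in ar Q S. \<exists>u' V. vars_at V u' \<subseteq> X \<and>
      ((u = u' \<and> (u', v) \<in> (par_rstep_at ar Q V)\<inverse> O ((rstep ar (S \<union> P'))\<^sup>*)\<inverse>) \<or>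
       ((u, u') \<in> rstep ar S O (rstep ar (S \<union> P'))\<^sup>* \<and>
        (u', v) \<in> (par_rstep_at ar Q V)\<inverse> O ((rstep ar (S \<union> P'))\<^sup>*)\<inverse>))"
    and CP_SQ: "CP ar S Q \<subseteq>
      ((rstep ar (S \<union> P'))\<^sup>* O par_rstep ar Q) \<union>
      ((rstep ar (S \<union> P'))\<^sup>* O par_rstep ar Q O ((rstep ar (S \<union> P'))\<^sup>*)\<inverse> O (rstep ar S)\<inverse>)"
begin

abbreviation rews (infix "\<rightarrow>\<^sup>*" 50) where
  "s \<rightarrow>\<^sup>* t \<equiv> (rew ar (S \<union> P'))\<^sup>*\<^sup>* s t"

abbreviation eqv (infix "\<sim>" 50) where
  "s \<sim> t \<equiv> par ar Q UNIV s t"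

lemma eqv_sym: "s \<sim> t \<Longrightarrow> t \<sim> s"
  using par_sym sym_Q by blast

lemma rews_S: "(rew ar S)\<^sup>*\<^sup>* s t \<Longrightarrow> s \<rightarrow>\<^sup>* t"
  by (rule rews_mono) auto

lemma rew_S: "rew ar S s t \<Longrightarrow> s \<rightarrow>\<^sup>* t"
  by (rule rews_S) blast

definition joinable :: "('f, 'v) trm \<Rightarrow> ('f, 'v) trm \<Rightarrow> bool" where
  "joinable u v \<longleftrightarrow> (\<exists>a b. u \<rightarrow>\<^sup>* a \<and> v \<rightarrow>\<^sup>* b \<and> a \<sim> b)"

text \<open>Closes a peak \<open>u \<sim> t\<close>, \<open>t \<rightarrow> v\<close> with an \<open>S\<close>-step at \<open>t\<close>.\<close>

definition closes :: "('f, 'v) trm \<Rightarrow> ('f, 'v) trm \<Rightarrow> bool" where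
  "closes u v \<longleftrightarrow> (\<exists>b. v \<rightarrow>\<^sup>* b \<and> b \<sim> u) \<or>
     (\<exists>u' a b. rew ar S u u' \<and> u' \<rightarrow>\<^sup>* a \<and> v \<rightarrow>\<^sup>* b \<and> b \<sim> a)"

lemma joinable_refl: "joinable t t"
  unfolding joinable_def using par_refl by blast

lemma closes_refl: "closes t t"
  unfolding closes_def using par_refl by blast

lemma joinable_sym: "joinable u v \<Longrightarrow> joinable v u"
  unfolding joinable_def using eqv_sym by blast

lemma joinable_subst: "joinable u v \<Longrightarrow> is_subst ar \<delta> \<Longrightarrow> joinable (u \<cdot> \<delta>) (v \<cdot> \<delta>)"
  unfolding joinable_def using rews_subst par_UNIV_subst by meson

lemma closes_subst: "closes u v \<Longrightarrow> is_subst ar \<delta> \<Longrightarrow> closes (u \<cdot> \<delta>) (v \<cdot> \<delta>)"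
  unfolding closes_def by (meson rew_subst rews_subst par_UNIV_subst)

lemma CP_SS_joinable:
  assumes "(u, v) \<in> CP ar S S" shows "joinable u v"
proof -
  from CP_SS assms obtain a b where "(u, a) \<in> (rstep ar (S \<union> P'))\<^sup>*" "(b, a) \<in> par_rstep ar Q"
    "(v, b) \<in> (rstep ar (S \<union> P'))\<^sup>*" by blast
  then show ?thesis unfolding joinable_def using rsteps_rews par_rstep_par eqv_sym by meson
qed

lemma CP_SQ_closes:
  assumes "(v, u) \<in> CP ar S Q" shows "closes u v"
proof -
  from CP_SQ assms consider
    b where "(v, b) \<in> (rstep ar (S \<union> P'))\<^sup>*" "(b, u) \<in> par_rstep ar Q"
    | b a u' where "(v, b) \<in> (rstep ar (S \<union> P'))\<^sup>*" "(b, a) \<in> par_rstep ar Q"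
      "(u', a) \<in> (rstep ar (S \<union> P'))\<^sup>*" "(u, u') \<in> rstep ar S" by blast
  then show ?thesis
    by cases (unfold closes_def, (meson rsteps_rews par_rstep_par rstep_rew)+)
qed

section \<open>Peaks of two \<open>S\<close>-steps\<close>

lemma joinable_overlap:
  assumes "(l, r) \<in> S" "is_subst ar \<theta>" "rew ar S (l \<cdot> \<theta>) v"
  shows "joinable v (r \<cdot> \<theta>)"
  using rew_instance_cases[OF assms(3) S]
proof (elim disjE exE conjE)
  fix p l1 r1 \<theta>1
  assume p: "p \<in> poss l" "\<not> is_Var (subt_at l p)" "(l1, r1) \<in> S" "is_subst ar \<theta>1"
    "subt_at l p \<cdot> \<theta> = l1 \<cdot> \<theta>1" and v: "v = replace_at (l \<cdot> \<theta>) p (r1 \<cdot> \<theta>1)"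
  from CP_overlap[OF inf S S assms(1,2) p] show ?thesis
  proof (elim disjE exE conjE)
    assume "replace_at (l \<cdot> \<theta>) p (r1 \<cdot> \<theta>1) = r \<cdot> \<theta>"
    then show ?thesis unfolding v using joinable_refl by simp
  next
    fix u w \<tau> assume "(u, w) \<in> CP ar S S" "is_subst ar \<tau>"
      "replace_at (l \<cdot> \<theta>) p (r1 \<cdot> \<theta>1) = u \<cdot> \<tau>" "r \<cdot> \<theta> = w \<cdot> \<tau>"
    then show ?thesis unfolding v using CP_SS_joinable joinable_subst by metis
  qed
next
  fix x s assume x: "rew ar S (\<theta> x) s" "(rew ar S)\<^sup>*\<^sup>* v (l \<cdot> \<theta>(x := s))"
  have "wf_trm ar s" using rew_wf[OF x(1) S] assms(2) by (auto simp: is_subst_def)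
  then have "is_subst ar (\<theta>(x := s))"
    by (intro is_subst_finite_change[OF assms(2), of "{x}"]) auto
  \<comment> \<open>Once all copies of \<open>\<theta> x\<close> in \<open>l\<close> have been
    rewritten, the rule applies again at the root.\<close>
  then have "(rew ar S)\<^sup>*\<^sup>* v (r \<cdot> \<theta>(x := s))"
    using x(2) rew.root[OF assms(1)] by (meson rtranclp.rtrancl_into_rtrancl)
  moreover have "(rew ar S)\<^sup>*\<^sup>* (r \<cdot> \<theta>) (r \<cdot> \<theta>(x := s))" using x(1) by (rule rews_update_subst)
  ultimately show ?thesis unfolding joinable_def using rews_S par_refl by metis
qed

lemma rew_rew_joinable:
  assumes "rew ar S t u" "rew ar S t v" shows "joinable u v"
  using assms
proof (induction arbitrary: v rule: rew.induct)
  case (root l r \<sigma>)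
  then show ?case using joinable_overlap joinable_sym by blast
next
  case (arg ts i u f)
  have step: "rew ar S (Fun f ts) (Fun f (ts[i := u]))" using arg by (intro rew.arg)
  from arg.prems show ?case
  proof (cases rule: rew.cases)
    case (root l r \<sigma>)
    then show ?thesis using joinable_overlap step by metis
  next
    case (arg j w)
    then have j: "j < length ts" "rew ar S (ts ! j) w" and v: "v = Fun f (ts[j := w])" by auto
    show ?thesis
    proof (cases "i = j")
      case True
      with arg.IH j obtain a b where ab: "u \<rightarrow>\<^sup>* a" "w \<rightarrow>\<^sup>* b" "a \<sim> b"
        unfolding joinable_def by blast
      have "Fun f (ts[i := u]) \<rightarrow>\<^sup>* Fun f (ts[i := a])" "v \<rightarrow>\<^sup>* Fun f (ts[i := b])"
        unfolding v using ab True j(1) by (auto intro!: rews_args simp: nth_list_update)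
      moreover have "Fun f (ts[i := a]) \<sim> Fun f (ts[i := b])"
        using ab(3) arg.hyps(2) by (intro par.args) (auto simp: nth_list_update par_refl)
      ultimately show ?thesis unfolding joinable_def by blast
    next
      case False
      let ?w = "Fun f (ts[i := u, j := w])"
      have "Fun f (ts[i := u]) \<rightarrow>\<^sup>* ?w" "v \<rightarrow>\<^sup>* ?w"
        unfolding v using False j arg.hyps(2) rew_S[OF j(2)] rew_S[OF arg.hyps(1)]
        by (auto intro!: rews_args simp: nth_list_update)
      then show ?thesis unfolding joinable_def using par_refl by blast
    qed
  qed
qed

section \<open>Peaks of a parallel step and an \<open>S\<close>-step\<close>

text \<open>The parallel step is a single root step here, so overlaps fall under (iii), whose pairs
  have the result of the \<open>S\<close>-step as first component.\<close>

lemma closes_root_eqv: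
  assumes "(l, r) \<in> Q" "is_subst ar \<theta>" "rew ar S (l \<cdot> \<theta>) v"
  shows "closes (r \<cdot> \<theta>) v"
  using rew_instance_cases[OF assms(3) S]
proof (elim disjE exE conjE)
  fix p l1 r1 \<theta>1
  assume p: "p \<in> poss l" "\<not> is_Var (subt_at l p)" "(l1, r1) \<in> S" "is_subst ar \<theta>1"
    "subt_at l p \<cdot> \<theta> = l1 \<cdot> \<theta>1" and v: "v = replace_at (l \<cdot> \<theta>) p (r1 \<cdot> \<theta>1)"
  from CP_overlap[OF inf S Q assms(1,2) p] show ?thesis
  proof (elim disjE exE conjE)
    assume "replace_at (l \<cdot> \<theta>) p (r1 \<cdot> \<theta>1) = r \<cdot> \<theta>"
    then show ?thesis unfolding v using closes_refl by simp
  next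
    fix u w \<tau> assume "(u, w) \<in> CP ar S Q" "is_subst ar \<tau>"
      "replace_at (l \<cdot> \<theta>) p (r1 \<cdot> \<theta>1) = u \<cdot> \<tau>" "r \<cdot> \<theta> = w \<cdot> \<tau>"
    then show ?thesis unfolding v using CP_SQ_closes closes_subst by metis
  qed
next
  fix x s assume x: "x \<in> vars l" "rew ar S (\<theta> x) s" "(rew ar S)\<^sup>*\<^sup>* v (l \<cdot> \<theta>(x := s))"
  have "wf_trm ar s" using rew_wf[OF x(2) S] assms(2) by (auto simp: is_subst_def)
  then have "is_subst ar (\<theta>(x := s))"
    by (intro is_subst_finite_change[OF assms(2), of "{x}"]) auto
  then have "l \<cdot> \<theta>(x := s) \<sim> r \<cdot> \<theta>(x := s)" using assms(1) by (intro par.root) auto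
  \<comment> \<open>By symmetry the rules of \<open>Q\<close> have the same variables on both sides.
    So \<open>x\<close> survives in \<open>r\<close> and an \<open>S\<close>-step is available
    there, as the second alternative of \<open>closes\<close> requires.\<close>
  moreover have "(r, l) \<in> Q" using assms(1) sym_Q by auto
  then have "x \<in> vars r" using x(1) is_trsD(4)[OF Q] by blast
  from rew_update_subst[of ar S \<theta> x s, OF x(2) this] obtain u' where
    "rew ar S (r \<cdot> \<theta>) u'" "(rew ar S)\<^sup>*\<^sup>* u' (r \<cdot> \<theta>(x := s))" by blast
  ultimately show ?thesis unfolding closes_def using x(3) rews_S by blast
qed

text \<open>The parallel step joining the pair is instantiated by \<open>\<tau>\<close> at its
  source and by \<open>\<tau>'\<close> at its target, and the variable condition keeps it a single
  parallel step. The remaining steps need one substitution each: \<open>\<tau>\<close> on the side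
  of \<open>v0\<close>, \<open>\<tau>'\<close> on the side of \<open>u0\<close>.\<close>

lemma PCP_closes:
  assumes PCP: "(u0, v0, X) \<in> PCP_in ar Q S" and \<tau>: "is_subst ar \<tau>" "is_subst ar \<tau>'"
    and \<tau>\<tau>': "\<And>x. \<tau> x \<sim> \<tau>' x" "\<And>x. x \<in> X \<Longrightarrow> \<tau>' x = \<tau> x"
  shows "closes (u0 \<cdot> \<tau>') (v0 \<cdot> \<tau>)"
proof -
  have inst: "v0 \<cdot> \<tau> \<rightarrow>\<^sup>* w \<cdot> \<tau>" "w \<cdot> \<tau> \<sim> u' \<cdot> \<tau>'"
    if "vars_at V u' \<subseteq> X" "(w, u') \<in> par_rstep_at ar Q V" "(v0, w) \<in> (rstep ar (S \<union> P'))\<^sup>*" for w u' V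
  proof -
    show "v0 \<cdot> \<tau> \<rightarrow>\<^sup>* w \<cdot> \<tau>" using rsteps_rews[OF that(3)] \<tau>(1) by (rule rews_subst)
    show "w \<cdot> \<tau> \<sim> u' \<cdot> \<tau>'"
      by (rule par_subst[OF par_rstep_at_par[OF that(2,1)] \<tau>(1) \<tau>\<tau>'])
  qed
  from PCP_QS PCP obtain u' V where V: "vars_at V u' \<subseteq> X" and
    *: "(u0 = u' \<and> (u', v0) \<in> (par_rstep_at ar Q V)\<inverse> O ((rstep ar (S \<union> P'))\<^sup>*)\<inverse>) \<or>
       ((u0, u') \<in> rstep ar S O (rstep ar (S \<union> P'))\<^sup>* \<and>
        (u', v0) \<in> (par_rstep_at ar Q V)\<inverse> O ((rstep ar (S \<union> P'))\<^sup>*)\<inverse>)" by blast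
  then obtain w where w: "(w, u') \<in> par_rstep_at ar Q V" "(v0, w) \<in> (rstep ar (S \<union> P'))\<^sup>*" by blast
  note inst = inst[OF V w]
  from * show ?thesis
  proof (elim disjE conjE)
    assume "u0 = u'"
    then show ?thesis using inst unfolding closes_def by blast
  next
    assume "(u0, u') \<in> rstep ar S O (rstep ar (S \<union> P'))\<^sup>*"
    then obtain u1 where "(u0, u1) \<in> rstep ar S" "(u1, u') \<in> (rstep ar (S \<union> P'))\<^sup>*" by blast
    then have "rew ar S (u0 \<cdot> \<tau>') (u1 \<cdot> \<tau>')" "u1 \<cdot> \<tau>' \<rightarrow>\<^sup>* u' \<cdot> \<tau>'"
      using rew_subst[OF rstep_rew \<tau>(2)] rews_subst[OF rsteps_rews \<tau>(2)] by blast+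
    then show ?thesis using inst unfolding closes_def by blast
  qed
qed

text \<open>If no redex of the parallel step overlaps the left-hand side, linearity keeps the rule
  applicable at the root afterwards; otherwise a parallel critical pair takes over.\<close>

lemma closes_root_S:
  assumes lr: "(Fun f ts, r) \<in> S" and \<theta>: "is_subst ar \<theta>" and len: "length us = length ts"
    and eqv: "\<And>i. i < length ts \<Longrightarrow> ts ! i \<cdot> \<theta> \<sim> us ! i"
  shows "closes (Fun f us) (r \<cdot> \<theta>)"
proof -
  have lin_l: "linear_trm (Fun f ts)" using lr lin by (auto simp: left_linear_def)
  have "\<exists>os \<theta>'. par_overlaps ar Q (ts ! i) \<theta> os \<theta>' (us ! i)" if "i < length ts" for i
    using par_overlaps_exists[OF eqv[OF that] linear_Fun_arg[OF lin_l that]] .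
  from par_overlaps_Fun[OF lin_l len this] obtain os \<theta>' where
    ov: "par_overlaps ar Q (Fun f ts) \<theta> os \<theta>' (Fun f us)" and os: "[] \<notin> fst ` set os" by blast
  show ?thesis
  proof (cases "os = []")
    case True
    then have u: "Fun f us = Fun f ts \<cdot> \<theta>'" and \<theta>\<theta>': "\<And>x. \<theta> x \<sim> \<theta>' x"
      using ov by (auto simp: par_overlaps_def)
    have "rew ar S (Fun f us) (r \<cdot> \<theta>')"
      unfolding u using rew.root[OF lr par_overlaps_subst[OF ov \<theta> Q]] .
    \<comment> \<open>A non-linear \<open>r\<close> is no obstacle: all copies of
      \<open>\<theta> x\<close> move in the same parallel step.\<close>
    moreover have "r \<cdot> \<theta> \<sim> r \<cdot> \<theta>'" using \<theta>\<theta>' by (rule par_subst_refl)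
    ultimately show ?thesis unfolding closes_def by blast
  next
    case False
    from PCP_overlaps[OF inf Q S lr \<theta> ov False os] obtain u0 v0 X \<tau> \<tau>' where
      "(u0, v0, X) \<in> PCP_in ar Q S" "is_subst ar \<tau>" "is_subst ar \<tau>'"
      "\<And>x. \<tau> x \<sim> \<tau>' x" "\<And>x. x \<in> X \<Longrightarrow> \<tau>' x = \<tau> x"
      "r \<cdot> \<theta> = v0 \<cdot> \<tau>" "Fun f us = u0 \<cdot> \<tau>'" by blast
    then show ?thesis using PCP_closes by simp
  qed
qed

lemma eqv_rew_closes:
  assumes "t \<sim> u" "rew ar S t v" shows "closes u v"
  using assms
proof (induction arbitrary: v rule: par.induct)
  case (var x)
  then show ?case using no_rew_Var[OF S] by blast
next
  case (root l r \<theta>)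
  then show ?case using closes_root_eqv by blast
next
  case (args us ts f)
  from args.prems show ?case
  proof (cases rule: rew.cases)
    case (root l r \<sigma>)
    then obtain ls where l: "l = Fun f ls" "ts = map (\<lambda>t. t \<cdot> \<sigma>) ls"
      using is_trsD(3)[OF S root(3)] by (cases l) auto
    show ?thesis unfolding \<open>v = r \<cdot> \<sigma>\<close>
      by (rule closes_root_S) (use root l args.hyps in auto)
  next
    case (arg i w)
    then have i: "i < length ts" "rew ar S (ts ! i) w" and v: "v = Fun f (ts[i := w])" by auto
    \<comment> \<open>The parallel steps in the other arguments are kept and merge with the one from
      \<open>b\<close> to \<open>a\<close>, so the joining step is still a single parallel
      step.\<close>
    have sim: "Fun f (ts[i := b]) \<sim> Fun f (us[i := a])" if "b \<sim> a" for a b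
      using that args.hyps i(1) by (intro par.args) (auto simp: nth_list_update)
    have rews: "v \<rightarrow>\<^sup>* Fun f (ts[i := b])" if "w \<rightarrow>\<^sup>* b" for b
      unfolding v using that i(1) by (auto intro!: rews_args simp: nth_list_update)
    from args.IH[OF i] show ?thesis
      unfolding closes_def[of "us ! i"]
    proof (elim disjE exE conjE)
      fix b assume "w \<rightarrow>\<^sup>* b" "b \<sim> us ! i"
      then show ?thesis using sim[of b "us ! i"] rews unfolding closes_def by auto
    next
      fix u' a b assume *: "rew ar S (us ! i) u'" "u' \<rightarrow>\<^sup>* a" "w \<rightarrow>\<^sup>* b" "b \<sim> a"
      have "rew ar S (Fun f us) (Fun f (us[i := u']))"
        using *(1) i(1) args.hyps(1) by (intro rew.arg) auto
      moreover have "Fun f (us[i := u']) \<rightarrow>\<^sup>* Fun f (us[i := a])"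
        using *(2) i(1) args.hyps(1) by (auto intro!: rews_args simp: nth_list_update)
      ultimately show ?thesis using sim[OF *(4)] rews[OF *(3)] unfolding closes_def by blast
    qed
  qed
qed

section \<open>Return to \<open>rstep\<close> and use of the abstract theorem\<close>

lemma SP': "is_trs ar (S \<union> P')"
  using S P' by (auto simp: is_trs_def)

lemma rstep_Un: "rstep ar (R \<union> R') = rstep ar R \<union> rstep ar R'"
proof -
  have "(s, t) \<in> rstep ar (R \<union> R') \<longleftrightarrow> (s, t) \<in> rstep ar R \<or> (s, t) \<in> rstep ar R'" for s t
    unfolding rstep_def Un_iff mem_Collect_eq prod.case by blast
  then show ?thesis by auto
qed

lemma rews_lift:
  assumes "s \<rightarrow>\<^sup>* t" "wf_trm ar s"
  shows "(s, t) \<in> (rstep ar S \<union> rstep ar P')\<^sup>*" "wf_trm ar t"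
  using rews_rsteps[OF assms(1) SP' assms(2)] rews_wf[OF assms(1) SP'] assms(2)
  by (simp_all add: rstep_Un)

text \<open>Demanding well-formedness at the source is enough for symmetry, as the target inherits
  it.\<close>

definition eqv_rel :: "('f, 'v) trm rel" where
  "eqv_rel = {(s, t). wf_trm ar s \<and> s \<sim> t}"

lemma rstep_eqv_rel: "R \<subseteq> Q \<Longrightarrow> rstep ar R \<subseteq> eqv_rel"
proof (rule subrelI)
  fix s t assume R: "R \<subseteq> Q" and st: "(s, t) \<in> rstep ar R"
  then have "s \<sim> t" using rew_par[OF rew_mono[OF rstep_rew[OF st] R]] by simp
  then show "(s, t) \<in> eqv_rel" using st by (simp add: eqv_rel_def rstep_def)
qed

lemma sym_eqv_rel: "sym eqv_rel"
  using eqv_sym par_wf[OF _ Q] by (auto intro!: symI simp: eqv_rel_def)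

theorem conversion_valley:
  assumes "terminating_relative_to ar S P'"
  shows "(rstep ar S \<union> (rstep ar S)\<inverse> \<union> eqv_rel)\<^sup>* \<subseteq>
    (rstep ar S)\<^sup>* O eqv_rel\<^sup>* O ((rstep ar S)\<inverse>)\<^sup>*"
proof (rule peaks.church_rosser_modulo[of _ "rstep ar P'"], unfold_locales)
  show "wf ((rstep ar S O (rstep ar P')\<^sup>*)\<inverse>)"
    using assms unfolding wf_iff_no_infinite_down_chain terminating_relative_to_def by simp
  show "rstep ar P' \<subseteq> eqv_rel" using P'_Q by (rule rstep_eqv_rel)
  show "sym eqv_rel" by (rule sym_eqv_rel)
next
  fix t u v assume *: "(t, u) \<in> rstep ar S" "(t, v) \<in> rstep ar S"
  then have wf: "wf_trm ar u" "wf_trm ar v" by (auto simp: rstep_def)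
  from rew_rew_joinable[OF *[THEN rstep_rew]] obtain a b where
    ab: "u \<rightarrow>\<^sup>* a" "v \<rightarrow>\<^sup>* b" "a \<sim> b" unfolding joinable_def by blast
  show "\<exists>a b. (u, a) \<in> (rstep ar S \<union> rstep ar P')\<^sup>* \<and> (v, b) \<in> (rstep ar S \<union> rstep ar P')\<^sup>* \<and>
      (a, b) \<in> eqv_rel"
    using rews_lift[OF ab(1) wf(1)] rews_lift[OF ab(2) wf(2)] ab(3) unfolding eqv_rel_def by auto
next
  fix t u v assume *: "(t, u) \<in> eqv_rel" "(t, v) \<in> rstep ar S"
  then have tu: "t \<sim> u" and wf: "wf_trm ar u" "wf_trm ar v"
    using par_wf[OF _ Q] by (auto simp: rstep_def eqv_rel_def)
  from eqv_rew_closes[OF tu rstep_rew[OF *(2)]]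
  show "(\<exists>b. (v, b) \<in> (rstep ar S \<union> rstep ar P')\<^sup>* \<and> (b, u) \<in> eqv_rel) \<or>
      (\<exists>u' a b. (u, u') \<in> rstep ar S \<and> (u', a) \<in> (rstep ar S \<union> rstep ar P')\<^sup>* \<and>
        (v, b) \<in> (rstep ar S \<union> rstep ar P')\<^sup>* \<and> (b, a) \<in> eqv_rel)"
    unfolding closes_def
  proof (elim disjE exE conjE)
    fix b assume b: "v \<rightarrow>\<^sup>* b" "b \<sim> u"
    show ?thesis
      using rews_lift[OF b(1) wf(2)] b(2) unfolding eqv_rel_def by auto
  next
    fix u' a b assume u': "rew ar S u u'" and ab: "u' \<rightarrow>\<^sup>* a" "v \<rightarrow>\<^sup>* b" "b \<sim> a"
    have "(u, u') \<in> rstep ar S" "wf_trm ar u'"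
      using rew_rstep[OF u' S wf(1)] rew_wf[OF u' S] wf(1) by simp_all
    then show ?thesis
      using rews_lift[OF ab(1)] rews_lift[OF ab(2) wf(2)] ab(3) unfolding eqv_rel_def by auto
  qed
qed

end

section \<open>Consequences of reversibility\<close>

text \<open>The rule is itself a step of \<open>P\<close>, so \<open>r\<close> rewrites back to
  \<open>l\<close>. Rewriting creates no variables, and no step starts from a variable; together
  these make the reversed rule admissible in a TRS.\<close>

lemma reversible_rule:
  assumes P: "is_trs ar P" and rev: "reversible ar P" and lr: "(l, r) \<in> P"
  shows "vars l \<subseteq> vars r" "\<not> is_Var r"
proof -
  have step: "rew ar P l r" using rew.root[OF lr is_subst_Var] by simp
  then have "(l, r) \<in> rstep ar P" using rew_rstep[OF _ P] is_trsD(1)[OF P lr] by blast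
  then have rl: "(rew ar P)\<^sup>*\<^sup>* r l" using rev rsteps_rews unfolding reversible_def by blast
  then show "vars l \<subseteq> vars r"
    by (induction rule: rtranclp_induct) (use rew_vars[OF _ P] in blast)+
  show "\<not> is_Var r"
  proof
    assume "is_Var r"
    then obtain x where r: "r = Var x" by (cases r) auto
    from rl show False
    proof (cases rule: converse_rtranclpE)
      case base
      then show ?thesis using is_trsD(3)[OF P lr] r by (metis is_Var.simps(1))
    next
      case (step y)
      then show ?thesis using no_rew_Var[OF P] r by blast
    qed
  qed
qed

lemma reversible_is_trs:
  assumes P: "is_trs ar P" and rev: "reversible ar P"
  shows "is_trs ar (P \<union> P\<inverse>)"
  using P reversible_rule[OF P rev] is_trsD[OF P] unfolding is_trs_def by auto

lemma reversible_steps: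
  assumes P: "is_trs ar P" and rev: "reversible ar P"
  shows "(rstep ar (P \<union> P\<inverse>))\<^sup>* \<subseteq> (rstep ar P)\<^sup>*"
proof -
  have "(s, t) \<in> (rstep ar P)\<^sup>*" if st: "(s, t) \<in> rstep ar (P \<union> P\<inverse>)" for s t
  proof -
    have wf: "wf_trm ar s" "wf_trm ar t" using st by (auto simp: rstep_def)
    \<comment> \<open>A step by a reversed rule is a \<open>P\<close>-step read backwards, which
      reversibility turns into a forward sequence.\<close>
    from rstep_rew[OF st] have "rew ar P s t \<or> rew ar P t s"
    proof (induction rule: rew.induct)
      case (root l r \<sigma>)
      then show ?case by (auto intro: rew.root)
    next
      case (arg ts i u f)
      then show ?case
        using rew.arg[of ar P ts i u f] rew.arg[of ar P "ts[i := u]" i "ts ! i" f] by auto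
    qed
    then show ?thesis using rew_rstep[OF _ P] wf rev unfolding reversible_def by blast
  qed
  then show ?thesis by (intro rtrancl_subset_rtrancl) auto
qed

theorem theorem3p28:
  fixes ar :: "'f \<Rightarrow> nat"
    and P S P' :: "('f, 'v) rule set"
  assumes "infinite (UNIV :: 'v set)"
    and "is_trs ar P" and "is_trs ar S" and "is_trs ar P'"
    and "left_linear S"
    and "reversible ar P"
    and "P' \<subseteq> P \<union> P\<inverse>"
    and "terminating_relative_to ar S P'"
    and i: "CP ar S S \<subseteq>
          (rstep ar (S \<union> P'))\<^sup>* O (par_rstep ar (P \<union> P\<inverse>))\<inverse> O ((rstep ar (S \<union> P'))\<^sup>*)\<inverse>"
    and ii: "\<forall>(u, v, X) \<in> PCP_in ar (P \<union> P\<inverse>) S. \<exists>u' V. vars_at V u' \<subseteq> X \<and>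
          ((u = u' \<and>
            (u', v) \<in> (par_rstep_at ar (P \<union> P\<inverse>) V)\<inverse> O ((rstep ar (S \<union> P'))\<^sup>*)\<inverse>) \<or>
           ((u, u') \<in> rstep ar S O (rstep ar (S \<union> P'))\<^sup>* \<and>
            (u', v) \<in> (par_rstep_at ar (P \<union> P\<inverse>) V)\<inverse> O ((rstep ar (S \<union> P'))\<^sup>*)\<inverse>))"
    and iii: "CP ar S (P \<union> P\<inverse>) \<subseteq>
          ((rstep ar (S \<union> P'))\<^sup>* O par_rstep ar (P \<union> P\<inverse>)) \<union>
          ((rstep ar (S \<union> P'))\<^sup>* O par_rstep ar (P \<union> P\<inverse>) O
             ((rstep ar (S \<union> P'))\<^sup>*)\<inverse> O (rstep ar S)\<inverse>)"
  shows "confluent ar (S \<union> P)"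
proof -
  let ?Q = "P \<union> P\<inverse>"
  let ?A = "rstep ar S" and ?R = "rstep ar (S \<union> P)"
  have Q: "is_trs ar ?Q" using assms(2,6) by (rule reversible_is_trs)
  interpret reversible_system ar ?Q S P'
    by unfold_locales (use assms Q in auto)
  have R: "?R = ?A \<union> rstep ar P" by (rule rstep_Un)
  let ?H = eqv_rel
  \<comment> \<open>\<open>eqv_rel\<close> lies between one step of \<open>P\<close> and finitely
    many: the lower bound turns peaks of \<open>S \<union> P\<close> into conversions for the
    abstract theorem, the upper bound turns the middle of the resulting valley into
    \<open>P\<close>-steps.\<close>
  have H_P: "?H \<subseteq> (rstep ar P)\<^sup>*"
  proof (rule subrelI)
    fix s t assume "(s, t) \<in> ?H"
    then have "(s, t) \<in> (rstep ar ?Q)\<^sup>*"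
      using par_rews rews_rsteps[OF _ Q] unfolding eqv_rel_def by blast
    then show "(s, t) \<in> (rstep ar P)\<^sup>*" using reversible_steps[OF assms(2,6)] by blast
  qed
  have P_H: "rstep ar P \<subseteq> ?H" by (rule rstep_eqv_rel) simp
  have sym_H: "(s, t) \<in> ?H \<Longrightarrow> (t, s) \<in> ?H" for s t
    using sym_eqv_rel by (rule symD)
  have fwd: "?R\<^sup>* \<subseteq> (?A \<union> ?A\<inverse> \<union> ?H)\<^sup>*"
    unfolding R by (rule rtrancl_mono) (use P_H in blast)
  have bwd: "(?R\<inverse>)\<^sup>* \<subseteq> (?A \<union> ?A\<inverse> \<union> ?H)\<^sup>*"
    unfolding R by (rule rtrancl_mono) (use P_H sym_H in blast)
  have H_R: "?H\<^sup>* \<subseteq> ?R\<^sup>*"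
    unfolding R using rtrancl_subset_rtrancl[OF H_P] rtrancl_mono[of "rstep ar P"] by blast
  have A_R: "?A\<^sup>* \<subseteq> ?R\<^sup>*" unfolding R by (rule rtrancl_mono) blast
  show ?thesis
    unfolding confluent_def
  proof
    fix p assume "p \<in> (?R\<^sup>*)\<inverse> O ?R\<^sup>*"
    then obtain s t1 t2 where p: "p = (t1, t2)" and "(s, t1) \<in> ?R\<^sup>*" "(s, t2) \<in> ?R\<^sup>*" by blast
    then have "(t1, s) \<in> (?A \<union> ?A\<inverse> \<union> ?H)\<^sup>*" "(s, t2) \<in> (?A \<union> ?A\<inverse> \<union> ?H)\<^sup>*"
      using fwd bwd by (auto simp: rtrancl_converse)
    then have "(t1, t2) \<in> ?A\<^sup>* O ?H\<^sup>* O (?A\<inverse>)\<^sup>*"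
      using conversion_valley[OF assms(8)] by (meson rtrancl_trans subsetD)
    then obtain a b where "(t1, a) \<in> ?A\<^sup>*" "(a, b) \<in> ?H\<^sup>*" "(t2, b) \<in> ?A\<^sup>*"
      by (auto simp: rtrancl_converse)
    \<comment> \<open>The middle part is appended to the descent from \<open>t1\<close>, so both
      sides meet in \<open>b\<close>.\<close>
    then have "(t1, b) \<in> ?R\<^sup>*" "(t2, b) \<in> ?R\<^sup>*"
      using A_R H_R by (meson rtrancl_trans subsetD)+
    then show "p \<in> ?R\<^sup>* O (?R\<^sup>*)\<inverse>" unfolding p by blast
  qed
qed

end
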